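(* Let $F$ be an algebraically closed field and let $S$ be a $5$-element subset of $\mathrm{M}_3(F)$. Then $S$ is an irredundant generating set for $\mathrm{M}_3(F)$ if and only if there is $\alpha\in F$ such that $S\sim S_\alpha$, where $$S_{\alpha} :=\left\{ \begin{bmatrix}1 & 1 & 0 \\ 0 & 0 & 0 \\ 0 & 0 & 0\end{bmatrix}, \begin{bmatrix}0 & 0 & 0 \\ 1 & 1 & 0 \\ 0 & 0 & 0\end{bmatrix}, \begin{bmatrix}0 & 0 & 0 \\ 0 & 1 & 1 \\ 0 & 0 & 0\end{bmatrix}, \begin{bmatrix}0 & 0 & 0 \\ 0 & 0 & 0 \\ 0 & 1 & 1\end{bmatrix}, \begin{bmatrix}1 & 0 & 0 \\ 0 & 0 & 0 \\ 0 & 0 & \alpha\end{bmatrix} \right\}.$$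
   Context: A subset $S\subseteq \mathrm{M}_n(F)$ is called an irredundant generating set for $\mathrm{M}_n(F)$ if $S$ generates $\mathrm{M}_n(F)$ as a unital $F$-algebra and no proper subset of $S$ does. Consider the following operations on subsets of $\mathrm{M}_n(F)$: (1) conjugating all elements of the set by some (common) $g\in \mathrm{GL}_n(F)$; (2) transposing all elements of the set; (3) replacing one matrix $a$ in the set with $\alpha a+\beta I$ for some $\alpha,\beta\in F$ with $\alpha\neq 0$. For $S,T\subseteq \mathrm{M}_n(F)$, write $S\sim T$ if $S$ can be transformed into $T$ by a finite sequence of operations (1)--(3). *)

theory Defs
  imports "HOL-Analysis.Analysis" "HOL-Computational_Algebra.Polynomial"
begin

definition unital_subalgebra :: "('a::field ^ 'n ^ 'n) set \<Rightarrow> bool" where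
  "unital_subalgebra A \<longleftrightarrow>
     mat 1 \<in> A \<and>
     (\<forall>a\<in>A. \<forall>b\<in>A. a + b \<in> A \<and> a ** b \<in> A) \<and>
     (\<forall>c. \<forall>a\<in>A. map_matrix ((*) c) a \<in> A)"

definition generates_matrix_algebra :: "('a::field ^ 'n ^ 'n) set \<Rightarrow> bool" where
  "generates_matrix_algebra S \<longleftrightarrow> unital_subalgebra hull S = UNIV"

definition irredundant_generating_set :: "('a::field ^ 'n ^ 'n) set \<Rightarrow> bool" where
  "irredundant_generating_set S \<longleftrightarrow>
     generates_matrix_algebra S \<and> (\<forall>T. T \<subset> S \<longrightarrow> \<not> generates_matrix_algebra T)"

text \<open>
  In the rule \<open>affine\<close>, the new matrix may already belong to the set, in which case the set
  shrinks. No step ever enlarges a finite set, so no such collapse occurs along a chain of steps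
  between two finite sets of equal cardinality.
\<close>

inductive elementary_step :: "('a::field ^ 'n ^ 'n) set \<Rightarrow> ('a ^ 'n ^ 'n) set \<Rightarrow> bool" where
  conjugate: "invertible g \<Longrightarrow> elementary_step S ((\<lambda>a. g ** a ** matrix_inv g) ` S)"
| transpose: "elementary_step S (transpose ` S)"
| affine: "a \<in> S \<Longrightarrow> \<alpha> \<noteq> 0 \<Longrightarrow>
    elementary_step S (insert (map_matrix ((*) \<alpha>) a + mat \<beta>) (S - {a}))"

definition matset_sim :: "('a::field ^ 'n ^ 'n) set \<Rightarrow> ('a ^ 'n ^ 'n) set \<Rightarrow> bool"
    (infix \<open>\<sim>\<close> 50) where
  "S \<sim> T \<longleftrightarrow> elementary_step\<^sup>*\<^sup>* S T"

definition S_alpha :: "'a::field \<Rightarrow> ('a ^ 3 ^ 3) set" where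
  "S_alpha \<alpha> =
    {vector [vector [1, 1, 0], vector [0, 0, 0], vector [0, 0, 0]],
     vector [vector [0, 0, 0], vector [1, 1, 0], vector [0, 0, 0]],
     vector [vector [0, 0, 0], vector [0, 1, 1], vector [0, 0, 0]],
     vector [vector [0, 0, 0], vector [0, 0, 0], vector [0, 1, 1]],
     vector [vector [1, 0, 0], vector [0, 0, 0], vector [0, 0, \<alpha>]]}"

end

theory Submission
  imports Defs
begin

text \<open>
  By Burnside's theorem a set of matrices fails to generate \<open>M\<^sub>3(F)\<close> iff its elements have a common
  eigenvector or their transposes have one. So if \<open>S\<close> is irredundant, each \<open>a \<in> S\<close> has a point (or a
  line) of the projective plane that is fixed by all elements of \<open>S\<close> except \<open>a\<close>. Three such points are
  never collinear, since their line would be invariant under \<open>S\<close>. Hence there are no four of them, as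
  an element fixing four points in general position is scalar. Up to transposition, \<open>S\<close> therefore
  comes with three points and two lines. The two elements belonging to the lines are diagonal in the
  basis given by the points, which forces each line to pass through exactly one of the points, and the two
  lines through different ones. All such configurations are projectively equivalent, and in suitable
  coordinates the fixed points and lines determine every element up to affine change, except for one
  diagonal matrix that contributes the parameter \<open>\<alpha>\<close>.
\<close>

section \<open>Generation and elementary steps\<close>

lemma unital_subalgebra_hull: "unital_subalgebra (unital_subalgebra hull S)"
  by (rule hull_in) (auto simp: unital_subalgebra_def)

lemma generates_matrix_algebra_iff:
  "generates_matrix_algebra S \<longleftrightarrow> (\<forall>A. unital_subalgebra A \<and> S \<subseteq> A \<longrightarrow> A = UNIV)"
  unfolding generates_matrix_algebra_def
  by (metis UNIV_I hull_minimal hull_subset subset_UNIV subset_antisym unital_subalgebra_hull)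

text \<open>The matrix inserted by the rule \<open>affine\<close>. The case \<alpha> = 0 is allowed
  and yields a scalar matrix, which is how vanishing coefficients are excluded later.\<close>

definition affine_image :: "'a::field \<Rightarrow> 'a \<Rightarrow> 'a^'n^'n \<Rightarrow> 'a^'n^'n" where
  "affine_image \<alpha> \<beta> a = map_matrix ((*) \<alpha>) a + mat \<beta>"

lemma map_matrix_mat_1: "map_matrix ((*) c) (mat 1) = (mat c :: 'a::field^'n^'n)"
  by (simp add: vec_eq_iff mat_def)

lemma unital_subalgebra_affine_image:
  assumes "unital_subalgebra A" "a \<in> A"
  shows "affine_image \<alpha> \<beta> a \<in> A"
  using assms map_matrix_mat_1[of \<beta>] unfolding unital_subalgebra_def affine_image_def by metis

lemma affine_image_inverse:
  "\<alpha> \<noteq> 0 \<Longrightarrow> affine_image (inverse \<alpha>) (- \<beta> / \<alpha>) (affine_image \<alpha> \<beta> a) = a"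
  by (simp add: affine_image_def vec_eq_iff mat_def field_simps)

lemma unital_subalgebra_affine_image_iff:
  assumes "unital_subalgebra A" "\<alpha> \<noteq> 0"
  shows "affine_image \<alpha> \<beta> a \<in> A \<longleftrightarrow> a \<in> A"
  using assms affine_image_inverse unital_subalgebra_affine_image by metis

text \<open>An affine change with \<alpha> \<noteq> 0 is undone by another one, so a subalgebra
  contains \<open>a\<close> exactly if it contains the image of \<open>a\<close>.\<close>

lemma generates_insert_affine_image:
  assumes "\<alpha> \<noteq> 0"
  shows "generates_matrix_algebra (insert (affine_image \<alpha> \<beta> a) T)
    \<longleftrightarrow> generates_matrix_algebra (insert a T)"
  using assms unfolding generates_matrix_algebra_iff
  by (simp add: unital_subalgebra_affine_image_iff cong: conj_cong)

text \<open>A subalgebra containing the image pulls back to one containing \<open>S\<close>, hence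
  to everything. A hypothesis on preimages of subalgebras also covers transposition, which reverses
  products.\<close>

lemma generates_image:
  assumes "bij \<phi>" "\<And>A. unital_subalgebra A \<Longrightarrow> unital_subalgebra (\<phi> -` A)"
    "generates_matrix_algebra S"
  shows "generates_matrix_algebra (\<phi> ` S)"
  unfolding generates_matrix_algebra_iff
proof (intro allI impI)
  fix A assume A: "unital_subalgebra A \<and> \<phi> ` S \<subseteq> A"
  then have "\<phi> -` A = UNIV"
    using assms(2,3) unfolding generates_matrix_algebra_iff by blast
  then show "A = UNIV"
    using \<open>bij \<phi>\<close> by (metis bij_is_surj surj_image_vimage_eq)
qed

lemma irredundant_image_iff:
  assumes "inj \<phi>" "\<And>T. generates_matrix_algebra (\<phi> ` T) \<longleftrightarrow> generates_matrix_algebra T"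
  shows "irredundant_generating_set (\<phi> ` S) \<longleftrightarrow> irredundant_generating_set S"
proof -
  have *: "(\<exists>T. T \<subset> \<phi> ` S \<and> generates_matrix_algebra T)
      \<longleftrightarrow> (\<exists>T. T \<subset> S \<and> generates_matrix_algebra (\<phi> ` T))"
  proof
    assume "\<exists>T. T \<subset> \<phi> ` S \<and> generates_matrix_algebra T"
    then obtain U where "\<phi> ` U \<subset> \<phi> ` S" "U \<subseteq> S" "generates_matrix_algebra (\<phi> ` U)"
      by (metis psubset_imp_subset subset_image_iff)
    then show "\<exists>T. T \<subset> S \<and> generates_matrix_algebra (\<phi> ` T)"
      by blast
  next
    assume "\<exists>T. T \<subset> S \<and> generates_matrix_algebra (\<phi> ` T)"
    then show "\<exists>T. T \<subset> \<phi> ` S \<and> generates_matrix_algebra T"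
      by (metis assms(1) image_strict_mono inj_on_subset subset_UNIV)
  qed
  then show ?thesis
    unfolding irredundant_generating_set_def assms(2)[of S] using assms(2) by blast
qed

section \<open>Invariance of irredundance under the three operations\<close>

lemma conjugate_inverse:
  fixes g :: "'a::field^'n^'n"
  assumes "g ** h = mat 1" "h ** g = mat 1"
  shows "g ** (h ** a ** g) ** h = a"
  by (metis assms(1) matrix_mul_assoc matrix_mul_lid matrix_mul_rid)

lemma generates_conjugate:
  fixes g :: "'a::field^'n^'n"
  assumes gh: "g ** h = mat 1" "h ** g = mat 1" and "generates_matrix_algebra S"
  shows "generates_matrix_algebra ((\<lambda>a. g ** a ** h) ` S)"
proof (rule generates_image[OF _ _ assms(3)])
  show "bij (\<lambda>a. g ** a ** h)"
    by (rule o_bij[of "\<lambda>a. h ** a ** g"]) (auto simp: fun_eq_iff conjugate_inverse gh)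
next
  fix A :: "('a^'n^'n) set"
  assume A: "unital_subalgebra A"
  have "g ** (a ** b) ** h = (g ** a ** h) ** (g ** b ** h)" for a b
    by (metis gh(2) matrix_mul_assoc matrix_mul_rid)
  moreover have "g ** (a + b) ** h = g ** a ** h + g ** b ** h" for a b
    by (simp add: matrix_add_ldistrib matrix_matrix_mult_def vec_eq_iff sum.distrib algebra_simps)
  moreover have "g ** map_matrix ((*) c) a ** h = map_matrix ((*) c) (g ** a ** h)" for a c
    by (simp add: matrix_matrix_mult_def vec_eq_iff sum_distrib_left sum_distrib_right mult_ac)
  ultimately show "unital_subalgebra ((\<lambda>a. g ** a ** h) -` A)"
    using A gh(1) by (simp add: unital_subalgebra_def)
qed

lemma generates_conjugate_iff:
  fixes g :: "'a::field^'n^'n"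
  assumes "g ** h = mat 1" "h ** g = mat 1"
  shows "generates_matrix_algebra ((\<lambda>a. g ** a ** h) ` S) \<longleftrightarrow> generates_matrix_algebra S"
proof
  assume "generates_matrix_algebra ((\<lambda>a. g ** a ** h) ` S)"
  from generates_conjugate[OF assms(2,1) this] show "generates_matrix_algebra S"
    by (simp add: image_image conjugate_inverse assms)
qed (rule generates_conjugate[OF assms])

lemma irredundant_conjugate_iff:
  fixes g :: "'a::field^'n^'n"
  assumes "g ** h = mat 1" "h ** g = mat 1"
  shows "irredundant_generating_set ((\<lambda>a. g ** a ** h) ` S) \<longleftrightarrow> irredundant_generating_set S"
proof (rule irredundant_image_iff)
  show "inj (\<lambda>a. g ** a ** h)"
    by (rule inj_on_inverseI[of _ "\<lambda>a. h ** a ** g"]) (simp add: conjugate_inverse assms)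
qed (rule generates_conjugate_iff[OF assms])

lemma transpose_add: "transpose (a + b) = transpose a + transpose b"
  by (simp add: transpose_def vec_eq_iff)

lemma transpose_map_matrix: "transpose (map_matrix f a) = map_matrix f (transpose a)"
  by (simp add: transpose_def vec_eq_iff)

lemma transpose_eq_iff: "transpose a = transpose b \<longleftrightarrow> a = b"
  by (metis transpose_transpose)

lemma inj_transpose: "inj transpose"
  by (simp add: inj_def transpose_eq_iff)

lemma generates_transpose:
  fixes S :: "('a::field^'n^'n) set"
  assumes "generates_matrix_algebra S"
  shows "generates_matrix_algebra (transpose ` S)"
proof (rule generates_image[OF _ _ assms])
  show "bij (transpose :: 'a::field^'n^'n \<Rightarrow> _)"
    by (rule involuntory_imp_bij) (rule transpose_transpose)
next
  fix A :: "('a::field^'n^'n) set"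
  assume A: "unital_subalgebra A"
  then show "unital_subalgebra (transpose -` A)"
    by (simp add: unital_subalgebra_def matrix_transpose_mul transpose_mat transpose_add transpose_map_matrix)
qed

lemma irredundant_transpose_iff:
  fixes S :: "('a::field^'n^'n) set"
  shows "irredundant_generating_set (transpose ` S) \<longleftrightarrow> irredundant_generating_set S"
proof (rule irredundant_image_iff)
  show "inj (transpose :: 'a^'n^'n \<Rightarrow> _)"
    by (rule inj_transpose)
  show "generates_matrix_algebra (transpose ` T) \<longleftrightarrow> generates_matrix_algebra T"
    for T :: "('a::field^'n^'n) set"
    using generates_transpose[of T] generates_transpose[of "transpose ` T"]
    by (auto simp: image_image)
qed

text \<open>In a subset containing \<open>a\<close>, replacing \<open>a\<close> by \<open>a'\<close>
  does not affect generation; a subset without \<open>a\<close> is itself a subset of the new set.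
  As \<open>a'\<close> lies outside \<open>S - {a}\<close>, proper inclusions stay proper.\<close>

lemma irredundant_affine_image:
  assumes irr: "irredundant_generating_set (insert a' (S - {a}))"
    and a': "a' = affine_image \<alpha> \<beta> a" "\<alpha> \<noteq> 0" "a \<in> S" "a' \<notin> S - {a}"
  shows "irredundant_generating_set S"
  unfolding irredundant_generating_set_def
proof (intro conjI allI impI)
  show "generates_matrix_algebra S"
    using irr a' generates_insert_affine_image[of \<alpha> \<beta> a "S - {a}"]
    by (simp add: irredundant_generating_set_def insert_absorb)
next
  fix T assume "T \<subset> S"
  show "\<not> generates_matrix_algebra T"
  proof (cases "a \<in> T")
    case True
    then have "insert a' (T - {a}) \<subset> insert a' (S - {a})"
      using \<open>T \<subset> S\<close> a'(4) by (auto simp: psubset_eq)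
    then have "\<not> generates_matrix_algebra (insert a' (T - {a}))"
      using irr unfolding irredundant_generating_set_def by blast
    then show ?thesis
      using generates_insert_affine_image[of \<alpha> \<beta> a "T - {a}"] a' True
      by (simp add: insert_absorb)
  next
    case False
    then have "T \<subset> insert a' (S - {a})"
      using \<open>T \<subset> S\<close> a'(3,4) by auto
    then show ?thesis
      using irr unfolding irredundant_generating_set_def by blast
  qed
qed

lemma matrix_inv_inverse:
  fixes g :: "'a::field^'n^'n"
  assumes "invertible g"
  shows "g ** matrix_inv g = mat 1" "matrix_inv g ** g = mat 1"
  using someI_ex[OF assms[unfolded invertible_def]] unfolding matrix_inv_def by auto

section \<open>Chains of elementary steps\<close>

lemma elementary_step_card:
  assumes "elementary_step S T" "finite S"
  shows "finite T \<and> card T \<le> card S"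
  using assms
proof cases
  case (affine a \<alpha> \<beta>)
  then have "card T \<le> Suc (card (S - {a}))"
    using assms(2) by (simp add: card_insert_le_m1 card_insert_if)
  then show ?thesis
    using affine assms(2) by (metis card.remove finite_Diff finite_insert)
qed (auto simp: assms(2) card_image_le)

lemma elementary_step_irredundant:
  assumes "elementary_step S T" "finite S" "card S = card T" "irredundant_generating_set T"
  shows "irredundant_generating_set S"
  using assms(1)
proof cases
  case (conjugate g)
  then show ?thesis
    using assms(4) irredundant_conjugate_iff[OF matrix_inv_inverse] by metis
next
  case transpose
  then show ?thesis
    using assms(4) irredundant_transpose_iff by metis
next
  case (affine a \<alpha> \<beta>)
  \<comment> \<open>Equal cardinalities exclude the collapse in which the new matrix is already
    present.\<close>
  have "map_matrix ((*) \<alpha>) a + mat \<beta> \<notin> S - {a}"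
  proof
    assume "map_matrix ((*) \<alpha>) a + mat \<beta> \<in> S - {a}"
    then have "T = S - {a}"
      using affine(1) by (simp add: insert_absorb)
    then show False
      using assms(2,3) affine(2) by (metis card_Diff1_less less_irrefl)
  qed
  with affine assms(4) show ?thesis
    using irredundant_affine_image unfolding affine_image_def by blast
qed

lemma matset_sim_irredundant:
  assumes "S \<sim> T" "finite S" "card S = card T" "irredundant_generating_set T"
  shows "irredundant_generating_set S"
proof -
  have "elementary_step\<^sup>*\<^sup>* S T"
    using assms(1) by (simp add: matset_sim_def)
  \<comment> \<open>The bound on cardinalities is carried along: in
    \<open>card T \<le> card U \<le> card S\<close> equality of the outer terms forces equality at
    every step of the chain.\<close>
  then have "finite S \<longrightarrow> card T \<le> card S \<and> (card S = card T \<longrightarrow> irredundant_generating_set S)"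
  proof (induction rule: converse_rtranclp_induct)
    case base
    then show ?case using assms(4) by simp
  next
    case (step S U)
    show ?case
    proof
      assume "finite S"
      then have U: "finite U" "card U \<le> card S"
        using elementary_step_card step.hyps(1) by blast+
      then show "card T \<le> card S \<and> (card S = card T \<longrightarrow> irredundant_generating_set S)"
        using elementary_step_irredundant[OF step.hyps(1) \<open>finite S\<close>] step.IH by auto
    qed
  qed
  then show ?thesis using assms by blast
qed

lemma matset_sim_trans: "S \<sim> T \<Longrightarrow> T \<sim> U \<Longrightarrow> S \<sim> U"
  unfolding matset_sim_def by (rule rtranclp_trans)

lemma matset_sim_step: "elementary_step S T \<Longrightarrow> S \<sim> T"
  unfolding matset_sim_def by (rule r_into_rtranclp)

lemma matset_sim_conjugate:
  fixes g :: "'a::field^'n^'n"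
  assumes "g ** h = mat 1" "h ** g = mat 1"
  shows "S \<sim> (\<lambda>a. g ** a ** h) ` S"
proof -
  have inv: "invertible g"
    using assms invertible_def by blast
  then have "matrix_inv g = h"
    by (metis assms(1) matrix_inv_inverse(2) matrix_mul_assoc matrix_mul_lid matrix_mul_rid)
  then show ?thesis
    using matset_sim_step[OF elementary_step.conjugate[OF inv, of S]] by simp
qed

text \<open>The elements are changed one at a time; \<open>U\<close> collects those already
  treated.\<close>

lemma matset_sim_affine_images:
  assumes irr: "irredundant_generating_set S" and fin: "finite S" and "\<forall>a\<in>S. \<alpha> a \<noteq> 0"
  shows "S \<sim> (\<lambda>a. affine_image (\<alpha> a) (\<beta> a) a) ` S"
proof -
  let ?f = "\<lambda>a. affine_image (\<alpha> a) (\<beta> a) a"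
  have "S \<sim> ?f ` U \<union> (S - U)" if "U \<subseteq> S" for U
    using finite_subset[OF that fin] that
  proof (induction U)
    case empty
    then show ?case by (simp add: matset_sim_def)
  next
    case (insert a U)
    \<comment> \<open>Otherwise removing \<open>a\<close> would also remove the image of an earlier
      element \<open>b\<close>. In that case \<open>a\<close> is an affine image of
      \<open>b\<close>, so \<open>S - {b}\<close> already generates, against irredundance.\<close>
    have "a \<notin> ?f ` U"
    proof
      assume "a \<in> ?f ` U"
      then obtain b where b: "b \<in> U" "a = ?f b" by blast
      then have "b \<in> S" "b \<noteq> a" "a \<in> S" "\<alpha> b \<noteq> 0"
        using insert assms(3) by auto
      then have "insert a (S - {b}) = S - {b}" "insert b (S - {b}) = S"
        by auto
      then have "generates_matrix_algebra (S - {b})"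
        using generates_insert_affine_image[OF \<open>\<alpha> b \<noteq> 0\<close>, of "\<beta> b" b "S - {b}"] b(2) irr
        by (simp add: irredundant_generating_set_def)
      then show False
        using irr \<open>b \<in> S\<close> unfolding irredundant_generating_set_def by blast
    qed
    then have "?f ` U \<union> (S - U) - {a} = ?f ` U \<union> (S - insert a U)"
      by blast
    then have eq: "insert (?f a) (?f ` U \<union> (S - U) - {a}) = ?f ` insert a U \<union> (S - insert a U)"
      by simp
    have "elementary_step (?f ` U \<union> (S - U)) (insert (?f a) (?f ` U \<union> (S - U) - {a}))"
      using elementary_step.affine[of a "?f ` U \<union> (S - U)" "\<alpha> a" "\<beta> a"] insert.hyps insert.prems assms(3)
      unfolding affine_image_def by blast
    then have "?f ` U \<union> (S - U) \<sim> ?f ` insert a U \<union> (S - insert a U)"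
      unfolding eq by (rule matset_sim_step)
    moreover have "S \<sim> ?f ` U \<union> (S - U)"
      using insert.IH insert.prems by simp
    ultimately show ?case
      by (rule matset_sim_trans[rotated])
  qed
  from this[of S] show ?thesis by simp
qed

section \<open>Vectors in three dimensions\<close>

text \<open>A bilinear pairing over any commutative ring. With \<open>u\<close> read as a line and
  \<open>v\<close> as a point of the projective plane, \<open>dot u v = 0\<close> is incidence;
  \<open>cross v w\<close> is then the line through \<open>v\<close> and \<open>w\<close>.\<close>

definition dot :: "'a::comm_ring_1^'n \<Rightarrow> 'a^'n \<Rightarrow> 'a" where
  "dot u v = (\<Sum>i\<in>UNIV. u $ i * v $ i)"

definition cross :: "'a::comm_ring_1^3 \<Rightarrow> 'a^3 \<Rightarrow> 'a^3" where
  "cross v w = vector [v$2 * w$3 - v$3 * w$2, v$3 * w$1 - v$1 * w$3, v$1 * w$2 - v$2 * w$1]"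

definition outer :: "'a::comm_ring_1^'m \<Rightarrow> 'a^'n \<Rightarrow> 'a^'n^'m" where
  "outer p q = (\<chi> i j. p $ i * q $ j)"

text \<open>The zero vector is not excluded; nonvanishing is stated separately where it
  matters.\<close>

definition eigenvec :: "'a::comm_ring_1^'n^'n \<Rightarrow> 'a^'n \<Rightarrow> bool" where
  "eigenvec a v \<longleftrightarrow> (\<exists>c. a *v v = c *s v)"

lemma eigenvec_transpose: "eigenvec (transpose a) u \<longleftrightarrow> (\<exists>c. u v* a = c *s u)"
  by (simp add: eigenvec_def)

lemma dot_matrix_vector: "dot u (a *v v) = dot (u v* a) v"
  unfolding dot_def matrix_vector_mult_def vector_matrix_mult_def
  by (simp add: sum_distrib_left sum_distrib_right mult_ac) (rule sum.swap)

lemma dot_simps: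
  "dot u (v + w) = dot u v + dot u w" "dot u (c *s v) = c * dot u v" "dot u 0 = 0"
  "dot (u + v) w = dot u w + dot v w" "dot (c *s u) v = c * dot u v" "dot 0 u = 0"
  "dot u (v - w) = dot u v - dot u w" "dot (u - v) w = dot u w - dot v w"
  by (simp_all add: dot_def sum.distrib sum_distrib_left algebra_simps sum_subtractf)

lemma dot_3: "dot u v = u$1 * v$1 + u$2 * v$2 + u$3 * v$3" for u v :: "'a::comm_ring_1^3"
  by (simp add: dot_def sum_3)

lemma cross_simps [simp]:
  "cross v w $ 1 = v$2 * w$3 - v$3 * w$2"
  "cross v w $ 2 = v$3 * w$1 - v$1 * w$3"
  "cross v w $ 3 = v$1 * w$2 - v$2 * w$1"
  by (simp_all add: cross_def)

lemma ex_dot_eq_1: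
  fixes v :: "'a::field^'n"
  assumes "v \<noteq> 0"
  shows "\<exists>u. dot u v = 1"
proof -
  obtain i where i: "v $ i \<noteq> 0"
    using assms by (auto simp: vec_eq_iff)
  have "dot (\<chi> j. if j = i then inverse (v $ i) else 0) v
      = (\<Sum>j\<in>UNIV. if j = i then inverse (v $ i) * v $ j else 0)"
    unfolding dot_def by (rule sum.cong) auto
  also have "\<dots> = 1"
    using i by simp
  finally have "dot (\<chi> j. if j = i then inverse (v $ i) else 0) v = 1" .
  then show ?thesis by blast
qed

lemma cross_eq_0_imp:
  fixes v w :: "'a::field^3"
  assumes "cross v w = 0" "v \<noteq> 0"
  shows "\<exists>c. w = c *s v"
proof -
  have e: "v$2 * w$3 = v$3 * w$2" "v$3 * w$1 = v$1 * w$3" "v$1 * w$2 = v$2 * w$1"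
    using assms(1) by (simp_all add: vec_eq_iff forall_3)
  obtain i where "v $ i \<noteq> 0"
    using assms by (auto simp: vec_eq_iff)
  then have "w = (w $ i / v $ i) *s v"
    using e exhaust_3[of i] by (auto simp: vec_eq_iff forall_3 field_simps)
  then show ?thesis by blast
qed

lemma cross_scale_self: "cross v (c *s v) = 0"
  by (simp add: vec_eq_iff forall_3 algebra_simps)

lemma dot_cross_self: "dot (cross p q) p = 0" "dot (cross p q) q = 0"
  by (simp_all add: dot_3 algebra_simps)

text \<open>Two distinct points lie on only one line. The reason is the expansion of the double
  cross product of \<open>p\<close>, \<open>q\<close> and \<open>r\<close>, which vanishes
  here.\<close>

lemma orthogonal_imp_multiple_cross:
  fixes p q r :: "'a::field^3"
  assumes "cross p q \<noteq> 0" "dot r p = 0" "dot r q = 0"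
  shows "\<exists>c. r = c *s cross p q"
proof (rule cross_eq_0_imp[OF _ assms(1)])
  have "cross (cross p q) r = dot r p *s q - dot r q *s p"
    by (simp add: vec_eq_iff forall_3 dot_3 algebra_simps)
  then show "cross (cross p q) r = 0"
    using assms by simp
qed

text \<open>Cramer's rule without division: \<open>dot (cross p q) r\<close> is the determinant of
  the three vectors, and the identity also holds when it is zero.\<close>

lemma cramer_3:
  "dot (cross p q) r *s x = dot (cross q r) x *s p + dot (cross r p) x *s q + dot (cross p q) x *s r"
  by (simp add: vec_eq_iff forall_3 dot_3 algebra_simps)

lemma basis_expansion_3:
  fixes p q r :: "'a::field^3"
  assumes "dot (cross p q) r \<noteq> 0"
  shows "\<exists>\<alpha> \<beta> \<gamma>. x = \<alpha> *s p + \<beta> *s q + \<gamma> *s r"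
proof -
  define d where "d = dot (cross p q) r"
  have "d *s x = dot (cross q r) x *s p + dot (cross r p) x *s q + dot (cross p q) x *s r"
    unfolding d_def by (rule cramer_3)
  then have "inverse d *s (d *s x)
      = inverse d *s (dot (cross q r) x *s p + dot (cross r p) x *s q + dot (cross p q) x *s r)"
    by simp
  then have "x = (inverse d * dot (cross q r) x) *s p + (inverse d * dot (cross r p) x) *s q
      + (inverse d * dot (cross p q) x) *s r"
    using assms by (simp add: d_def vector_add_ldistrib)
  then show ?thesis by blast
qed

text \<open>A vector \<open>t\<close> completes \<open>p\<close> and \<open>q\<close> to a basis of
  determinant 1. In Cramer's expansion of \<open>r\<close> in this basis the coefficient of
  \<open>t\<close> is \<open>dot (cross p q) r\<close>, which vanishes.\<close>

lemma span_expansion_3: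
  fixes p q r :: "'a::field^3"
  assumes "cross p q \<noteq> 0" "dot (cross p q) r = 0"
  shows "\<exists>\<alpha> \<beta>. r = \<alpha> *s p + \<beta> *s q"
proof -
  obtain t where t: "dot t (cross p q) = 1"
    using ex_dot_eq_1[OF assms(1)] by blast
  then have t: "dot (cross p q) t = 1"
    by (simp add: dot_def mult.commute)
  then show ?thesis
    using cramer_3[of p q t r] assms(2) by auto
qed

lemma matrix_eqI_vector: "(\<And>x. a *v x = b *v x) \<Longrightarrow> a = b" for a b :: "'a::comm_ring_1^'n^'m"
  by (simp add: matrix_eq)

lemma map_matrix_mult_vector: "map_matrix ((*) c) a *v y = c *s (a *v y)"
  by (simp add: matrix_vector_mult_def vec_eq_iff sum_distrib_left mult_ac)

section \<open>Burnside's theorem for 3 by 3 matrices\<close>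

lemma unital_subalgebra_transpose:
  assumes "unital_subalgebra A"
  shows "unital_subalgebra (transpose ` A)"
proof -
  have "transpose ` A = {a. transpose a \<in> A}"
    by (metis (no_types, lifting) image_iff mem_Collect_eq transpose_transpose subsetI subset_antisym)
  then show ?thesis
    using assms
    by (simp add: unital_subalgebra_def matrix_transpose_mul transpose_mat transpose_add transpose_map_matrix)
qed

text \<open>In dimension three a proper nonzero invariant subspace is either spanned by a common
  eigenvector or is a plane whose normal is a common eigenvector of the transposes. The two
  conditions therefore express irreducibility, in a form symmetric under transposition.\<close>

locale irreducible_subalgebra =
  fixes A :: "('a::field^3^3) set"
  assumes subalgebra: "unital_subalgebra A"
    and no_eigenvec: "v \<noteq> 0 \<Longrightarrow> \<exists>a\<in>A. \<not> eigenvec a v"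
    and no_left_eigenvec: "v \<noteq> 0 \<Longrightarrow> \<exists>a\<in>A. \<not> eigenvec (transpose a) v"
begin

lemma closed:
  "a \<in> A \<Longrightarrow> b \<in> A \<Longrightarrow> a + b \<in> A" "a \<in> A \<Longrightarrow> b \<in> A \<Longrightarrow> a ** b \<in> A"
  "a \<in> A \<Longrightarrow> map_matrix ((*) c) a \<in> A" "mat 1 \<in> A"
  using subalgebra by (auto simp: unital_subalgebra_def)

text \<open>Some \<open>b\<close> moves \<open>v\<close> out of its line. If some
  \<open>c *v v\<close> leaves the plane of \<open>v\<close> and \<open>b *v v\<close>, the three
  vectors form a basis. If none does, all elements of \<open>A\<close> map this plane into itself,
  and its normal \<open>u\<close> is a forbidden common left eigenvector.\<close>

lemma transitive:
  assumes "v \<noteq> 0"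
  shows "\<exists>a\<in>A. a *v v = x"
proof -
  obtain b where b: "b \<in> A" "\<not> eigenvec b v"
    using no_eigenvec assms by blast
  define u where "u = cross v (b *v v)"
  have "u \<noteq> 0"
    using b cross_eq_0_imp[OF _ assms] unfolding u_def eigenvec_def by blast
  show ?thesis
  proof (cases "\<exists>c\<in>A. dot u (c *v v) \<noteq> 0")
    case True
    then obtain c where "c \<in> A" "dot u (c *v v) \<noteq> 0" by blast
    then obtain \<alpha> \<beta> \<gamma> where "x = \<alpha> *s v + \<beta> *s (b *v v) + \<gamma> *s (c *v v)"
      using basis_expansion_3 unfolding u_def by blast
    then have "(map_matrix ((*) \<alpha>) (mat 1) + map_matrix ((*) \<beta>) b + map_matrix ((*) \<gamma>) c) *v v = x"
      by (simp only: matrix_vector_mult_add_rdistrib map_matrix_mult_vector matrix_vector_mul_lid)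
    moreover have "map_matrix ((*) \<alpha>) (mat 1) + map_matrix ((*) \<beta>) b + map_matrix ((*) \<gamma>) c \<in> A"
      by (intro closed b \<open>c \<in> A\<close>)
    ultimately show ?thesis ..
  next
    case False
    then have 0: "dot u (c *v v) = 0" if "c \<in> A" for c
      using that by blast
    have "eigenvec (transpose a) u" if "a \<in> A" for a
    proof -
      have "dot (u v* a) v = 0"
        using 0[OF that] by (simp only: dot_matrix_vector)
      moreover have "dot (u v* a) (b *v v) = 0"
        using 0[OF closed(2)[OF that b(1)]]
        by (simp only: dot_matrix_vector[symmetric] matrix_vector_mul_assoc)
      ultimately show ?thesis
        unfolding eigenvec_transpose u_def
        using orthogonal_imp_multiple_cross[OF \<open>u \<noteq> 0\<close>[unfolded u_def]] by metis
    qed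
    then show ?thesis
      using no_left_eigenvec \<open>u \<noteq> 0\<close> by blast
  qed
qed

lemma irreducible_transpose: "irreducible_subalgebra (transpose ` A)"
  by standard (simp_all add: unital_subalgebra_transpose subalgebra no_eigenvec no_left_eigenvec
      del: transpose_matrix_vector)

lemma transitive_left: "u \<noteq> 0 \<Longrightarrow> \<exists>a\<in>A. u v* a = x"
  using irreducible_subalgebra.transitive[OF irreducible_transpose] by fastforce

end

section \<open>Singular elements and elements of rank one\<close>

lemma singular_iff_ker:
  fixes a :: "'a::field^'n^'n"
  shows "det a = 0 \<longleftrightarrow> (\<exists>k. k \<noteq> 0 \<and> a *v k = 0)"
  using invertible_det_nz[of a] invertible_left_inverse[of a] matrix_left_invertible_ker[of a]
  by blast

lemma ex_eigenvalue_3: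
  fixes a :: "'a::alg_closed_field^3^3"
  shows "\<exists>c. det (a + mat (- c)) = 0"
proof -
  \<comment> \<open>The coefficients of the determinant of a - c I as a polynomial in c:
    determinant, minus the sum of the principal 2 by 2 minors, trace, -1.\<close>
  define f :: "nat \<Rightarrow> 'a" where "f k = (if k = 0 then det a else if k = 1 then
      - (a$1$1 * a$2$2 - a$1$2 * a$2$1 + a$1$1 * a$3$3 - a$1$3 * a$3$1 + a$2$2 * a$3$3 - a$2$3 * a$3$2)
    else if k = 2 then a$1$1 + a$2$2 + a$3$3 else - 1)" for k
  obtain c where "(\<Sum>k\<le>3. f k * c ^ k) = 0"
    using alg_closed[of 3 f] by (auto simp: f_def)
  moreover have "det (a + mat (- c)) = (\<Sum>k\<le>3. f k * c ^ k)"
    by (simp add: f_def det_3 mat_def numeral_3_eq_3 numeral_2_eq_2 algebra_simps)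
  ultimately show ?thesis by metis
qed

lemma ex_root_quadratic:
  fixes \<alpha> \<beta> :: "'a::alg_closed_field"
  shows "\<exists>c. c * c + \<beta> * c = \<alpha>"
proof -
  obtain c where "(\<Sum>k\<le>2. (if k = 0 then - \<alpha> else if k = 1 then \<beta> else 1) * c ^ k) = 0"
    using alg_closed[of 2 "\<lambda>k. if k = 0 then - \<alpha> else if k = 1 then \<beta> else 1"] by auto
  then have "c * c + \<beta> * c = \<alpha>"
    by (simp add: numeral_2_eq_2 algebra_simps)
  then show ?thesis ..
qed

text \<open>Every row of \<open>T\<close> is orthogonal to \<open>k\<close> and \<open>y\<close>,
  hence a multiple of their cross product.\<close>

lemma outer_of_kernel:
  fixes T :: "'a::field^3^3"
  assumes "T *v k = 0" "T *v y = 0" "cross k y \<noteq> 0"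
  shows "\<exists>p. T = outer p (cross k y)"
proof -
  have "\<exists>c. T $ i = c *s cross k y" for i
  proof (rule orthogonal_imp_multiple_cross[OF assms(3)])
    have "dot (T $ i) x = (T *v x) $ i" for x
      by (simp add: dot_def matrix_vector_mult_def)
    then show "dot (T $ i) k = 0" "dot (T $ i) y = 0"
      using assms by simp_all
  qed
  then obtain c where c: "\<And>i. T $ i = c i *s cross k y" by metis
  have "T = outer (\<chi> i. c i) (cross k y)"
    by (simp add: vec_eq_iff outer_def c del: cross_simps)
  then show ?thesis ..
qed

lemma ex_nonzero_image: "T \<noteq> 0 \<Longrightarrow> \<exists>x. T *v x \<noteq> 0" for T :: "'a::comm_ring_1^'n^'m"
  by (metis matrix_eqI_vector matrix_vector_mult_0)

lemma matrix_vector_mult_axis: "(T *v axis j 1) $ i = T $ i $ j"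
proof -
  have "(\<Sum>k\<in>UNIV. T $ i $ k * axis j 1 $ k) = (\<Sum>k\<in>UNIV. if k = j then T $ i $ k else 0)"
    by (rule sum.cong) (auto simp: axis_def)
  then show ?thesis by (simp add: matrix_vector_mult_def)
qed

lemma outer_of_image:
  fixes T :: "'a::field^3^3"
  assumes "T \<noteq> 0" "\<And>x y. cross (T *v x) (T *v y) = 0"
  shows "\<exists>p q. T = outer p q"
proof -
  obtain x where "T *v x \<noteq> 0"
    using ex_nonzero_image assms by blast
  then have "\<exists>c. T *v y = c *s (T *v x)" for y
    using assms cross_eq_0_imp by blast
  then obtain c where c: "\<And>y. T *v y = c y *s (T *v x)" by metis
  have "T $ i $ j = (T *v x) $ i * c (axis j 1)" for i j
    using arg_cong[OF c[of "axis j 1"], of "\<lambda>y. y $ i"]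
    by (simp add: matrix_vector_mult_axis mult.commute)
  then have "T = outer (T *v x) (\<chi> j. c (axis j 1))"
    unfolding vec_eq_iff outer_def by simp
  then show ?thesis by blast
qed

lemma outer_eq_0: "outer 0 q = 0" "outer p 0 = 0"
  by (simp_all add: outer_def vec_eq_iff)

lemma matrix_mult_outer: "a ** outer p q = outer (a *v p) q" "outer p q ** a = outer p (q v* a)"
  by (simp_all add: outer_def vec_eq_iff matrix_matrix_mult_def matrix_vector_mult_def
      vector_matrix_mult_def sum_distrib_left sum_distrib_right mult_ac)

lemma mat_mult_vector: "mat c *v y = c *s y" for y :: "'a::field^'n"
  by (metis map_matrix_mat_1 map_matrix_mult_vector matrix_vector_mul_lid)

text \<open>Subtracting an eigenvalue from a nonscalar element. The existence of eigenvalues is a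
  hypothesis because the locale lives over an arbitrary field.\<close>

lemma (in irreducible_subalgebra) ex_singular:
  assumes "\<And>a. \<exists>c. det ((a :: 'a^3^3) + mat (- c)) = 0"
  shows "\<exists>T\<in>A. T \<noteq> 0 \<and> det T = 0"
proof -
  obtain a where a: "a \<in> A" "\<not> eigenvec a (axis 1 1)"
    using no_eigenvec[of "axis 1 1"] by (auto simp: axis_eq_0_iff)
  obtain c where "det (a + mat (- c)) = 0"
    using assms by blast
  moreover have "a + mat (- c) \<in> A"
    using unital_subalgebra_affine_image[OF subalgebra a(1), of 1 "- c"]
    by (simp add: affine_image_def map_matrix_def)
  moreover have "a + mat (- c) \<noteq> 0"
  proof
    assume "a + mat (- c) = 0"
    moreover have "a = a + mat (- c) + mat c"
      by (simp add: vec_eq_iff mat_def)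
    ultimately have "a = mat c"
      by simp
    then show False
      using a mat_mult_vector unfolding eigenvec_def by blast
  qed
  ultimately show ?thesis by blast
qed

text \<open>
  If \<open>T\<close> is singular of rank two, then \<open>T ** S\<close> acts on the plane \<open>range T\<close>, and for an
  eigenvalue \<open>\<lambda>\<close> of this action \<open>(T ** S - \<lambda>) ** T\<close> has smaller rank than \<open>T\<close>. Choosing \<open>S\<close> with
  \<open>S (T x) = y\<close> makes it nonzero.
\<close>

lemma ex_rank_one:
  fixes A :: "('a::alg_closed_field^3^3) set"
  assumes "irreducible_subalgebra A"
  shows "\<exists>p q. outer p q \<in> A \<and> p \<noteq> 0 \<and> q \<noteq> 0"
proof -
  interpret irreducible_subalgebra A by fact
  have "\<exists>p q T. T \<in> A \<and> T \<noteq> 0 \<and> T = outer p q"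
  proof -
    obtain T where T: "T \<in> A" "T \<noteq> 0" "det T = 0"
      using ex_singular[OF ex_eigenvalue_3] by blast
    obtain k where k: "k \<noteq> 0" "T *v k = 0"
      using T singular_iff_ker by blast
    obtain l where l: "l \<noteq> 0" "l v* T = 0"
      using T singular_iff_ker[of "transpose T"] by auto
    show ?thesis
    proof (cases "\<forall>x y. cross (T *v x) (T *v y) = 0")
      case True
      then show ?thesis using T outer_of_image by metis
    next
      case False
      then obtain x y where xy: "cross (T *v x) (T *v y) \<noteq> 0" by blast
      have "T *v x \<noteq> 0"
        using xy by (auto simp: vec_eq_iff forall_3)
      then obtain S where S: "S \<in> A" "S *v (T *v x) = y"
        using transitive by blast
      \<comment> \<open>The left kernel vector \<open>l\<close> is a normal of the plane spanned by
        \<open>T *v x\<close> and \<open>T *v y\<close>, so this plane contains the whole range of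
        \<open>T\<close>.\<close>
      have "dot l (T *v z) = 0" for z
        by (simp add: dot_matrix_vector l dot_simps)
      moreover then obtain d where d: "l = d *s cross (T *v x) (T *v y)"
        using orthogonal_imp_multiple_cross[OF xy] by blast
      moreover have "d \<noteq> 0"
        using d l by auto
      ultimately have "dot (cross (T *v x) (T *v y)) (T *v (S *v (T *v y))) = 0"
        by (simp add: dot_simps)
      then obtain \<alpha> \<beta> where ab: "T *v (S *v (T *v y)) = \<alpha> *s (T *v x) + \<beta> *s (T *v y)"
        using span_expansion_3[OF xy] by blast
      \<comment> \<open>On the basis \<open>T *v x\<close>, \<open>T *v y\<close> the operator
        \<open>T ** S\<close> has characteristic polynomial X^2 - \<beta> X - \<alpha>. For a root
        \<open>c\<close> of this equation, \<open>\<beta> + c\<close> is an eigenvalue with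
        eigenvector \<open>T *v (y + c *s x)\<close>.\<close>
      obtain c where c: "c * c + \<beta> * c = \<alpha>"
        using ex_root_quadratic by blast
      define T' where "T' = T ** S ** T + map_matrix ((*) (- (\<beta> + c))) T"
      have T': "T' *v z = T *v (S *v (T *v z)) - (\<beta> + c) *s (T *v z)" for z
        unfolding T'_def
        by (simp add: matrix_vector_mult_add_rdistrib map_matrix_mult_vector
            flip: matrix_vector_mul_assoc)
      have "T' \<in> A"
        unfolding T'_def by (intro closed T S)
      moreover have "T' *v x \<noteq> 0"
      proof
        assume "T' *v x = 0"
        then have "T *v y = (\<beta> + c) *s (T *v x)"
          by (simp add: T' S)
        then show False using xy cross_scale_self by metis
      qed
      moreover have "T' *v k = 0"
        by (simp add: T' k)
      moreover have "T' *v (y + c *s x) = 0"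
      proof -
        have "T' *v (y + c *s x) = (\<alpha> - (c * c + \<beta> * c)) *s (T *v x)"
          by (simp add: T' ab S matrix_vector_right_distrib vector_scalar_commute
              vec_eq_iff algebra_simps)
        then show ?thesis using c by simp
      qed
      \<comment> \<open>The kernel of \<open>T'\<close> thus contains two independent vectors, so
        \<open>T'\<close> has rank one.\<close>
      moreover have "cross k (y + c *s x) \<noteq> 0"
      proof
        assume "cross k (y + c *s x) = 0"
        then obtain d where "y + c *s x = d *s k"
          using cross_eq_0_imp k by blast
        then have "T *v (y + c *s x) = 0"
          by (simp add: k vector_scalar_commute)
        then have "T *v y = (- c) *s (T *v x)"
          by (simp add: matrix_vector_right_distrib vector_scalar_commute eq_neg_iff_add_eq_0)
        then show False using xy cross_scale_self by metis
      qed
      ultimately show ?thesis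
        using outer_of_kernel by (metis matrix_vector_mult_0)
    qed
  qed
  then show ?thesis using outer_eq_0 by metis
qed

text \<open>One rank one element suffices: transitivity on both sides moves its two factors to
  arbitrary vectors, and every matrix is a sum of three such products, one for each row.\<close>

theorem burnside_3:
  fixes A :: "('a::alg_closed_field^3^3) set"
  assumes "irreducible_subalgebra A"
  shows "A = UNIV"
proof -
  interpret irreducible_subalgebra A by fact
  obtain p q where pq: "outer p q \<in> A" "p \<noteq> 0" "q \<noteq> 0"
    using ex_rank_one[OF assms] by blast
  have outer: "outer s r \<in> A" for s r
  proof -
    obtain a b where ab: "a \<in> A" "a *v p = s" "b \<in> A" "q v* b = r"
      using transitive[OF pq(2)] transitive_left[OF pq(3)] by metis
    have "a ** outer p q ** b \<in> A"
      by (intro closed ab pq)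
    then show ?thesis by (simp add: matrix_mult_outer ab)
  qed
  have "B = outer (axis 1 1) (B $ 1) + outer (axis 2 1) (B $ 2) + outer (axis 3 1) (B $ 3)" for B :: "'a^3^3"
    by (simp add: vec_eq_iff forall_3 outer_def axis_def)
  then have "B \<in> A" for B
    using outer closed(1) by metis
  then show ?thesis by blast
qed

section \<open>Generation and common eigenvectors\<close>

lemma not_generates_common_eigenvec:
  fixes S :: "('a::alg_closed_field^3^3) set"
  assumes "\<not> generates_matrix_algebra S"
  shows "(\<exists>v. v \<noteq> 0 \<and> (\<forall>a\<in>S. eigenvec a v)) \<or> (\<exists>u. u \<noteq> 0 \<and> (\<forall>a\<in>S. eigenvec (transpose a) u))"
proof (rule ccontr)
  assume "\<not> ?thesis"
  then have "irreducible_subalgebra (unital_subalgebra hull S)"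
    by unfold_locales (blast intro: unital_subalgebra_hull hull_inc)+
  then show False
    using burnside_3 assms unfolding generates_matrix_algebra_def by blast
qed

text \<open>The matrices that preserve \<open>W\<close> form a subalgebra, so all matrices preserve
  \<open>W\<close>. Rank one matrices then carry \<open>v\<close> to any vector.\<close>

lemma generates_no_invariant:
  fixes S :: "('a::field^'n^'n) set"
  assumes "generates_matrix_algebra S" "vec.subspace W" "v \<in> W" "v \<noteq> 0"
    and inv: "\<And>a w. a \<in> S \<Longrightarrow> w \<in> W \<Longrightarrow> a *v w \<in> W"
  shows "W = UNIV"
proof -
  have "unital_subalgebra {a. \<forall>w\<in>W. a *v w \<in> W}"
    using assms(2) unfolding unital_subalgebra_def vec.subspace_def
    by (auto simp: matrix_vector_mult_add_rdistrib map_matrix_mult_vector simp flip: matrix_vector_mul_assoc)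
  then have all: "a *v w \<in> W" if "w \<in> W" for a w
    using assms(1) inv that unfolding generates_matrix_algebra_iff by blast
  obtain u where u: "dot u v = 1"
    using ex_dot_eq_1 assms by blast
  have "outer x u *v v = x" for x
  proof -
    have "outer x u *v v = dot u v *s x"
      by (simp add: outer_def matrix_vector_mult_def dot_def vec_eq_iff sum_distrib_left sum_distrib_right mult_ac)
    then show ?thesis using u by simp
  qed
  then show ?thesis using all[OF assms(3)] by (metis UNIV_eq_I)
qed

lemma eigenvec_scale:
  fixes v :: "'a::field^'n"
  assumes "c \<noteq> 0"
  shows "eigenvec a (c *s v) \<longleftrightarrow> eigenvec a v"
proof -
  have "a *v (c *s v) = d *s (c *s v) \<longleftrightarrow> a *v v = d *s v" for d
    using assms by (auto simp: vector_scalar_commute vec_eq_iff)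
  then show ?thesis unfolding eigenvec_def by simp
qed

lemma eigenvec_mat: "eigenvec (mat c) v" for v :: "'a::field^'n"
  unfolding eigenvec_def using mat_mult_vector by blast

lemma generates_no_common_eigenvec:
  fixes S :: "('a::field^3^3) set"
  assumes "generates_matrix_algebra S" "v \<noteq> 0"
  shows "\<exists>a\<in>S. \<not> eigenvec a v"
proof (rule ccontr)
  assume "\<not> ?thesis"
  then have ev: "eigenvec a v" if "a \<in> S" for a
    using that by blast
  have "vec.span {v} = UNIV"
  proof (rule generates_no_invariant[OF assms(1) vec.subspace_span _ assms(2)])
    show "v \<in> vec.span {v}"
      by (simp add: vec.span_base)
    show "a *v w \<in> vec.span {v}" if a: "a \<in> S" and w: "w \<in> vec.span {v}" for a w
    proof -
      obtain c where c: "w = c *s v"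
        using w unfolding vec.span_singleton by (rule rangeE)
      obtain d where d: "a *v v = d *s v"
        using ev[OF a] unfolding eigenvec_def by (rule exE)
      have "a *v w = (c * d) *s v"
        by (simp add: vector_scalar_commute c d)
      then show ?thesis
        by (simp add: vec.span_scale vec.span_base)
    qed
  qed
  then have "w \<in> range (\<lambda>c. c *s v)" for w
    by (simp add: vec.span_singleton)
  then have "cross v w = 0" for w
    using cross_scale_self[of v] by (metis imageE)
  from this[of "axis 1 1"] this[of "axis 2 1"] show False
    using assms(2) by (simp add: vec_eq_iff forall_3 axis_def)
qed

section \<open>Isolated eigenvectors\<close>

text \<open>A witness that \<open>a\<close> cannot be omitted: a point fixed by all of
  \<open>S\<close> except \<open>a\<close>. Witnessing lines are isolated vectors of the transposed
  set.\<close>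

definition isolated :: "('a::field^'n^'n) set \<Rightarrow> 'a^'n^'n \<Rightarrow> 'a^'n \<Rightarrow> bool" where
  "isolated S a v \<longleftrightarrow> v \<noteq> 0 \<and> \<not> eigenvec a v \<and> (\<forall>b\<in>S. b \<noteq> a \<longrightarrow> eigenvec b v)"

lemma isolated_transpose:
  "isolated (transpose ` S) (transpose a) u
    \<longleftrightarrow> u \<noteq> 0 \<and> \<not> eigenvec (transpose a) u \<and> (\<forall>b\<in>S. b \<noteq> a \<longrightarrow> eigenvec (transpose b) u)"
  unfolding isolated_def by (simp add: transpose_eq_iff)

lemma isolated_scale: "c \<noteq> 0 \<Longrightarrow> isolated S a v \<Longrightarrow> isolated S a (c *s v)"
  unfolding isolated_def by (simp add: eigenvec_scale)

text \<open>Burnside's theorem for \<open>S - {a}\<close> gives a common eigenvector on one side. It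
  cannot be an eigenvector for \<open>a\<close> as well, since \<open>S\<close> generates.\<close>

lemma irredundant_isolated:
  fixes S :: "('a::alg_closed_field^3^3) set"
  assumes "irredundant_generating_set S" "a \<in> S"
  shows "(\<exists>v. isolated S a v) \<or> (\<exists>u. isolated (transpose ` S) (transpose a) u)"
proof -
  have gen: "generates_matrix_algebra S" "generates_matrix_algebra (transpose ` S)"
    using assms generates_transpose by (auto simp: irredundant_generating_set_def)
  have "\<not> generates_matrix_algebra (S - {a})"
    using assms by (auto simp: irredundant_generating_set_def)
  from not_generates_common_eigenvec[OF this] show ?thesis
  proof (elim disjE exE conjE)
    fix v assume v: "v \<noteq> 0" "\<forall>b\<in>S - {a}. eigenvec b v"
    then have "\<not> eigenvec a v"
      using generates_no_common_eigenvec[OF gen(1) v(1)] by (metis Diff_iff singletonD)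
    then have "isolated S a v"
      using v unfolding isolated_def by simp
    then show ?thesis by blast
  next
    fix u assume u: "u \<noteq> 0" "\<forall>b\<in>S - {a}. eigenvec (transpose b) u"
    then have "\<not> eigenvec (transpose a) u"
      using generates_no_common_eigenvec[OF gen(2) u(1)] by (metis Diff_iff image_iff singletonD)
    then have "isolated (transpose ` S) (transpose a) u"
      using u unfolding isolated_transpose by simp
    then show ?thesis by blast
  qed
qed

lemma irredundant_not_scalar:
  fixes S :: "('a::alg_closed_field^3^3) set"
  assumes "irredundant_generating_set S" "a \<in> S"
  shows "a \<noteq> mat c"
proof
  assume "a = mat c"
  then have "eigenvec a v" "eigenvec (transpose a) v" for v
    by (simp_all add: eigenvec_mat transpose_mat)
  then show False
    using irredundant_isolated[OF assms] unfolding isolated_transpose by (simp add: isolated_def)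
qed

lemma isolated_cross_nonzero:
  fixes S :: "('a::field^3^3) set"
  assumes "isolated S a v" "isolated S b w" "a \<in> S" "a \<noteq> b"
  shows "cross v w \<noteq> 0"
proof
  assume "cross v w = 0"
  then obtain c where c: "w = c *s v"
    using assms(1) cross_eq_0_imp unfolding isolated_def by blast
  then have "c \<noteq> 0"
    using assms(2) by (auto simp: isolated_def)
  moreover have "eigenvec a w" "\<not> eigenvec a v"
    using assms by (auto simp: isolated_def)
  ultimately show False
    by (simp add: c eigenvec_scale)
qed

text \<open>A line through two distinct fixed points is fixed: the plane of \<open>p\<close> and
  \<open>q\<close> is invariant, so its normal is a left eigenvector.\<close>

lemma plane_eigenvec:
  fixes a :: "'a::field^3^3"
  assumes "cross p q \<noteq> 0" "dot u p = 0" "dot u q = 0" "u \<noteq> 0" "eigenvec a p" "eigenvec a q"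
  shows "eigenvec (transpose a) u"
proof -
  have "dot (u v* a) p = 0" "dot (u v* a) q = 0"
    using assms by (auto simp: eigenvec_def dot_simps dot_matrix_vector[symmetric])
  then obtain c d where cd: "u v* a = c *s cross p q" "u = d *s cross p q"
    using orthogonal_imp_multiple_cross[OF assms(1)] assms(2,3) by metis
  then have "d \<noteq> 0"
    using assms(4) by auto
  then have "u v* a = (c / d) *s u"
    unfolding cd(1) by (simp add: cd(2))
  then show ?thesis
    unfolding eigenvec_transpose by blast
qed

text \<open>Each element of \<open>S\<close> fixes at least two of the three points. If these were
  collinear, any two of them would span the same line, which would then be fixed by all of
  \<open>S\<close>.\<close>

lemma isolated_independent:
  fixes S :: "('a::field^3^3) set"
  assumes gen: "generates_matrix_algebra S"
    and "isolated S a v" "isolated S b w" "isolated S c x" "a \<in> S" "b \<in> S" "c \<in> S" "distinct [a, b, c]"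
  shows "dot (cross v w) x \<noteq> 0"
proof
  assume 0: "dot (cross v w) x = 0"
  have nz: "cross v w \<noteq> 0" "cross v x \<noteq> 0" "cross w x \<noteq> 0"
    using isolated_cross_nonzero[OF assms(2,3,5)] isolated_cross_nonzero[OF assms(2,4,5)]
      isolated_cross_nonzero[OF assms(3,4,6)] assms(8) by simp_all
  have "eigenvec (transpose d) (cross v w)" if "d \<in> S" for d
  proof -
    have "eigenvec d v \<and> eigenvec d w \<or> eigenvec d v \<and> eigenvec d x \<or> eigenvec d w \<and> eigenvec d x"
      using that assms unfolding isolated_def by auto
    then show ?thesis
      using plane_eigenvec[OF _ _ _ nz(1)] nz 0 dot_cross_self by metis
  qed
  then show False
    using generates_no_common_eigenvec[OF generates_transpose[OF gen] nz(1)] by auto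
qed

lemma eigenvalues_agree:
  fixes a :: "'a::field^'n^'n"
  assumes "u v* a = c *s u" "a *v v = d *s v" "dot u v \<noteq> 0"
  shows "c = d"
  using assms dot_matrix_vector[of u a v] by (simp add: dot_simps)

lemma scalar_on_basis:
  fixes a :: "'a::field^3^3"
  assumes "dot (cross p q) r \<noteq> 0" "a *v p = c *s p" "a *v q = c *s q" "a *v r = c *s r"
  shows "a = mat c"
proof (rule matrix_eqI_vector)
  fix x
  obtain \<alpha> \<beta> \<gamma> where "x = \<alpha> *s p + \<beta> *s q + \<gamma> *s r"
    using basis_expansion_3[OF assms(1)] by blast
  then show "a *v x = mat c *v x"
    by (simp add: mat_mult_vector matrix_vector_right_distrib vector_scalar_commute assms(2-)
        vector_add_ldistrib mult.commute)
qed

text \<open>The determinant conditions say that no three of the four points are collinear.\<close>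

lemma four_eigenvectors_scalar:
  fixes a :: "'a::field^3^3"
  assumes "dot (cross p q) r \<noteq> 0" "dot (cross p q) s \<noteq> 0" "dot (cross q r) s \<noteq> 0" "dot (cross r p) s \<noteq> 0"
    and ev: "eigenvec a p" "eigenvec a q" "eigenvec a r" "eigenvec a s"
  shows "\<exists>c. a = mat c"
proof -
  obtain c where c: "a *v s = c *s s"
    using ev by (auto simp: eigenvec_def)
  \<comment> \<open>The line through \<open>x\<close> and \<open>y\<close> is a left eigenvector
    that vanishes neither at \<open>z\<close> nor at \<open>s\<close>, so its eigenvalue agrees with
    those of both.\<close>
  have *: "a *v z = c *s z"
    if xyz: "dot (cross x y) z \<noteq> 0" "dot (cross x y) s \<noteq> 0" "eigenvec a x" "eigenvec a y" "eigenvec a z" for x y z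
  proof -
    obtain d where d: "a *v z = d *s z"
      using xyz by (auto simp: eigenvec_def)
    have "cross x y \<noteq> 0"
      using xyz(1) by (auto simp: dot_simps)
    then have "eigenvec (transpose a) (cross x y)"
      using plane_eigenvec[of x y "cross x y" a] dot_cross_self xyz by blast
    then obtain e where "cross x y v* a = e *s cross x y"
      by (auto simp: eigenvec_transpose)
    then have "e = d" "e = c"
      using eigenvalues_agree d c xyz(1,2) by blast+
    then show ?thesis using d by simp
  qed
  have "dot (cross q r) p = dot (cross p q) r" "dot (cross r p) q = dot (cross p q) r"
    by (simp_all add: dot_3 algebra_simps)
  then show ?thesis
    using scalar_on_basis[OF assms(1)] * assms by metis
qed

text \<open>The fifth element \<open>e\<close> fixes all four points, which are in general position,
  so it would be scalar.\<close>

lemma not_four_isolated: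
  fixes S :: "('a::alg_closed_field^3^3) set"
  assumes irr: "irredundant_generating_set S" and "distinct [a, b, c, d, e]" "{a, b, c, d, e} \<subseteq> S"
    and iso: "isolated S a p" "isolated S b q" "isolated S c r" "isolated S d s"
  shows False
proof -
  have gen: "generates_matrix_algebra S"
    using irr by (simp add: irredundant_generating_set_def)
  have ev: "eigenvec e p" "eigenvec e q" "eigenvec e r" "eigenvec e s"
    using assms unfolding isolated_def by auto
  have nz: "dot (cross p q) r \<noteq> 0" "dot (cross p q) s \<noteq> 0" "dot (cross q r) s \<noteq> 0" "dot (cross r p) s \<noteq> 0"
    using isolated_independent[OF gen] assms by auto
  show False
    using four_eigenvectors_scalar[OF nz ev] irredundant_not_scalar[OF irr, of e] assms(3) by auto
qed

section \<open>Normal form of three points and two lines\<close>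

lemma matset_sim_affine_function:
  assumes "irredundant_generating_set S" "finite S"
    and "\<forall>a\<in>S. \<exists>\<alpha> \<beta>. \<alpha> \<noteq> 0 \<and> a = affine_image \<alpha> \<beta> (f a)"
  shows "S \<sim> f ` S"
proof -
  obtain \<alpha> \<beta> where "\<forall>a\<in>S. \<alpha> a \<noteq> 0 \<and> a = affine_image (\<alpha> a) (\<beta> a) (f a)"
    using assms(3) by metis
  then have 1: "inverse (\<alpha> a) \<noteq> 0"
    and 2: "affine_image (inverse (\<alpha> a)) (- \<beta> a / \<alpha> a) a = f a" if "a \<in> S" for a
    using that affine_image_inverse by (metis nonzero_imp_inverse_nonzero, metis)
  have "S \<sim> (\<lambda>a. affine_image (inverse (\<alpha> a)) (- \<beta> a / \<alpha> a) a) ` S"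
    using matset_sim_affine_images[OF assms(1,2)] 1 by simp
  also have "(\<lambda>a. affine_image (inverse (\<alpha> a)) (- \<beta> a / \<alpha> a) a) ` S = f ` S"
    using 2 by (rule image_cong[OF refl])
  finally show ?thesis .
qed

abbreviation mat3 :: "'a::zero \<Rightarrow> 'a \<Rightarrow> 'a \<Rightarrow> 'a \<Rightarrow> 'a \<Rightarrow> 'a \<Rightarrow> 'a \<Rightarrow> 'a \<Rightarrow> 'a \<Rightarrow> 'a^3^3" where
  "mat3 a b c d e f g h i \<equiv> vector [vector [a, b, c], vector [d, e, f], vector [g, h, i]]"

text \<open>The three points of the reference configuration. Its two lines are
  \<open>vector [1, 0, 0]\<close> and \<open>vector [0, 0, 1]\<close>, treated by applying the first
  two criteria to the transpose.\<close>

lemma eigenvec_coordinates: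
  fixes b :: "'a::field^3^3"
  shows "eigenvec b (vector [1, 0, 0]) \<longleftrightarrow> b$2$1 = 0 \<and> b$3$1 = 0"
    "eigenvec b (vector [0, 0, 1]) \<longleftrightarrow> b$1$3 = 0 \<and> b$2$3 = 0"
    "eigenvec b (vector [1, - 1, 1]) \<longleftrightarrow>
      b$2$1 - b$2$2 + b$2$3 = - (b$1$1 - b$1$2 + b$1$3) \<and> b$3$1 - b$3$2 + b$3$3 = b$1$1 - b$1$2 + b$1$3"
  by (auto simp: eigenvec_def matrix_vector_mult_def vec_eq_iff forall_3 sum_3)

lemma transpose_entry: "transpose b $ i $ j = b $ j $ i"
  by (simp add: transpose_def)

lemmas vec3_simps = vec_eq_iff forall_3 affine_image_def mat_def eigenvec_coordinates transpose_entry

text \<open>Each statement drops one of the five conditions. The other four leave a single matrix up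
  to affine change, except when the point \<open>vector [1, - 1, 1]\<close> is dropped: then all
  diagonal matrices remain.\<close>

lemma eigenvec_normal_forms:
  fixes b :: "'a::field^3^3"
  shows "eigenvec b (vector [0, 0, 1]) \<Longrightarrow> eigenvec b (vector [1, - 1, 1]) \<Longrightarrow>
      eigenvec (transpose b) (vector [1, 0, 0]) \<Longrightarrow> eigenvec (transpose b) (vector [0, 0, 1]) \<Longrightarrow>
      b = affine_image (b$2$1) (b$1$1) (mat3 0 0 0 1 1 0 0 0 0)"
    and "eigenvec b (vector [1, 0, 0]) \<Longrightarrow> eigenvec b (vector [1, - 1, 1]) \<Longrightarrow>
      eigenvec (transpose b) (vector [1, 0, 0]) \<Longrightarrow> eigenvec (transpose b) (vector [0, 0, 1]) \<Longrightarrow>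
      b = affine_image (b$2$3) (b$1$1) (mat3 0 0 0 0 1 1 0 0 0)"
    and "eigenvec b (vector [1, 0, 0]) \<Longrightarrow> eigenvec b (vector [1, - 1, 1]) \<Longrightarrow>
      eigenvec b (vector [0, 0, 1]) \<Longrightarrow> eigenvec (transpose b) (vector [0, 0, 1]) \<Longrightarrow>
      b = affine_image (b$1$2) (b$3$3) (mat3 1 1 0 0 0 0 0 0 0)"
    and "eigenvec b (vector [1, 0, 0]) \<Longrightarrow> eigenvec b (vector [1, - 1, 1]) \<Longrightarrow>
      eigenvec b (vector [0, 0, 1]) \<Longrightarrow> eigenvec (transpose b) (vector [1, 0, 0]) \<Longrightarrow>
      b = affine_image (b$3$2) (b$1$1) (mat3 0 0 0 0 0 0 0 1 1)"
    and "eigenvec b (vector [1, 0, 0]) \<Longrightarrow> eigenvec b (vector [0, 0, 1]) \<Longrightarrow>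
      eigenvec (transpose b) (vector [1, 0, 0]) \<Longrightarrow> eigenvec (transpose b) (vector [0, 0, 1]) \<Longrightarrow>
      b = mat3 (b$1$1) 0 0 0 (b$2$2) 0 0 0 (b$3$3)"
  by (simp_all add: vec3_simps del: transpose_matrix_vector) (auto simp: algebra_simps)


lemma affine_image_0: "affine_image 0 \<beta> a = mat \<beta>"
  by (simp add: affine_image_def vec_eq_iff)

text \<open>Reversing the order of the coordinates is a symmetry of the reference configuration: it
  fixes the middle point and exchanges the other two points and the two lines.\<close>

lemma mat3_flip:
  "mat3 0 0 1 0 1 0 1 0 0 ** mat3 a b c d e f g h i ** mat3 0 0 1 0 1 0 1 0 0
    = (mat3 i h g f e d c b a :: 'a::field^3^3)"
  by (simp add: vec_eq_iff forall_3 matrix_matrix_mult_def sum_3)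

text \<open>The middle entry is moved to 0 and then, if possible, the first entry is scaled to 1.
  The exceptional case is that the first two entries agree.\<close>

lemma diagonal_normal_form:
  fixes x y z :: "'a::field"
  assumes "mat3 x 0 0 0 y 0 0 0 z \<noteq> mat y"
  shows "\<exists>p d. p \<noteq> 0 \<and> mat3 x 0 0 0 y 0 0 0 z = affine_image p y d \<and>
    ((\<exists>\<alpha>. d = mat3 1 0 0 0 0 0 0 0 \<alpha>) \<or> d = mat3 0 0 0 0 0 0 0 0 1)"
proof (cases "x = y")
  case True
  then have "z \<noteq> y"
    using assms by (auto simp: vec_eq_iff forall_3 mat_def)
  then show ?thesis
    using True by (intro exI[of _ "z - y"] exI[of _ "mat3 0 0 0 0 0 0 0 0 1"])
      (simp add: vec_eq_iff forall_3 mat_def affine_image_def)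
next
  case False
  then have "mat3 x 0 0 0 y 0 0 0 z = affine_image (x - y) y (mat3 1 0 0 0 0 0 0 0 ((z - y) / (x - y)))"
    by (simp add: vec_eq_iff forall_3 mat_def affine_image_def)
  moreover have "x - y \<noteq> 0"
    using False by simp
  ultimately show ?thesis by metis
qed

lemma coordinate_configuration_sim:
  fixes S :: "('a::alg_closed_field^3^3) set"
  assumes irr: "irredundant_generating_set S"
    and S: "S = {b1, b2, b3, b4, b5}" "distinct [b1, b2, b3, b4, b5]"
    and iso: "isolated S b1 (vector [1, 0, 0])" "isolated S b2 (vector [1, - 1, 1])"
      "isolated S b3 (vector [0, 0, 1])"
      "isolated (transpose ` S) (transpose b4) (vector [1, 0, 0])"
      "isolated (transpose ` S) (transpose b5) (vector [0, 0, 1])"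
  shows "\<exists>\<alpha>. S \<sim> S_alpha \<alpha>"
proof -
  let ?t1 = "mat3 0 0 0 1 1 0 0 0 0 :: 'a^3^3"
  let ?t3 = "mat3 0 0 0 0 1 1 0 0 0 :: 'a^3^3"
  let ?t4 = "mat3 1 1 0 0 0 0 0 0 0 :: 'a^3^3"
  let ?t5 = "mat3 0 0 0 0 0 0 0 1 1 :: 'a^3^3"
  let ?J = "mat3 0 0 1 0 1 0 1 0 0 :: 'a^3^3"
  have e: "eigenvec b (vector [1, 0, 0])" if "b \<in> S" "b \<noteq> b1" for b
    using that iso unfolding isolated_def by simp
  have w: "eigenvec b (vector [1, - 1, 1])" if "b \<in> S" "b \<noteq> b2" for b
    using that iso unfolding isolated_def by simp
  have e': "eigenvec b (vector [0, 0, 1])" if "b \<in> S" "b \<noteq> b3" for b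
    using that iso unfolding isolated_def by simp
  have l: "eigenvec (transpose b) (vector [1, 0, 0])" if "b \<in> S" "b \<noteq> b4" for b
    using that iso unfolding isolated_transpose by simp
  have l': "eigenvec (transpose b) (vector [0, 0, 1])" if "b \<in> S" "b \<noteq> b5" for b
    using that iso unfolding isolated_transpose by simp
  have inS: "b1 \<in> S" "b2 \<in> S" "b3 \<in> S" "b4 \<in> S" "b5 \<in> S" and "finite S"
    using S(1) by simp_all
  have nf: "b1 = affine_image (b1$2$1) (b1$1$1) ?t1" "b3 = affine_image (b3$2$3) (b3$1$1) ?t3"
      "b4 = affine_image (b4$1$2) (b4$3$3) ?t4" "b5 = affine_image (b5$3$2) (b5$1$1) ?t5"
      and b2: "b2 = mat3 (b2$1$1) 0 0 0 (b2$2$2) 0 0 0 (b2$3$3)"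
    using S(2) by (auto intro!: eigenvec_normal_forms e w e' l l' inS simp del: transpose_matrix_vector)
  have ns: "b \<noteq> mat c" if "b \<in> S" for b c
    using irredundant_not_scalar[OF irr that] .
  \<comment> \<open>A vanishing coefficient would make the element scalar.\<close>
  have nz: "b1$2$1 \<noteq> 0" "b3$2$3 \<noteq> 0" "b4$1$2 \<noteq> 0" "b5$3$2 \<noteq> 0"
    using nf ns inS by (metis affine_image_0)+
  obtain p d where d: "p \<noteq> 0" "b2 = affine_image p (b2$2$2) d"
      "(\<exists>\<alpha>. d = mat3 1 0 0 0 0 0 0 0 \<alpha>) \<or> d = mat3 0 0 0 0 0 0 0 0 1"
    using diagonal_normal_form[of "b2$1$1" "b2$2$2" "b2$3$3"] ns[OF inS(2)] b2 by metis
  define f where "f b = (if b = b1 then ?t1 else if b = b2 then d else if b = b3 then ?t3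
      else if b = b4 then ?t4 else ?t5)" for b
  have f: "f b1 = ?t1" "f b2 = d" "f b3 = ?t3" "f b4 = ?t4" "f b5 = ?t5"
    using S(2) by (auto simp: f_def)
  have "\<exists>\<alpha> \<beta>. \<alpha> \<noteq> 0 \<and> b = affine_image \<alpha> \<beta> (f b)" if "b \<in> S" for b
  proof -
    consider "b = b1" | "b = b2" | "b = b3" | "b = b4" | "b = b5"
      using \<open>b \<in> S\<close> S(1) by auto
    then show ?thesis
      using f nf nz d(1,2) by cases metis+
  qed
  then have "S \<sim> f ` S"
    by (intro matset_sim_affine_function[OF irr \<open>finite S\<close>] ballI)
  also have "f ` S = {?t1, d, ?t3, ?t4, ?t5}"
    unfolding S(1) image_insert image_empty f ..
  finally have sim: "S \<sim> {?t1, d, ?t3, ?t4, ?t5}" .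
  from d(3) show ?thesis
  proof (elim disjE exE)
    fix \<alpha> assume d: "d = mat3 1 0 0 0 0 0 0 0 \<alpha>"
    have "{?t1, d, ?t3, ?t4, ?t5} = S_alpha \<alpha>"
      unfolding S_alpha_def d by (simp only: insert_commute)
    with sim show ?thesis by metis
  next
    \<comment> \<open>The exceptional diagonal matrix: reversing the coordinates permutes the other
      four normal forms and leads to the parameter 0.\<close>
    assume d: "d = mat3 0 0 0 0 0 0 0 0 1"
    have "?J ** ?J = mat 1"
      by (simp add: vec_eq_iff forall_3 matrix_matrix_mult_def sum_3 mat_def)
    then have "{?t1, d, ?t3, ?t4, ?t5} \<sim> (\<lambda>a. ?J ** a ** ?J) ` {?t1, d, ?t3, ?t4, ?t5}"
      by (intro matset_sim_conjugate)
    also have "(\<lambda>a. ?J ** a ** ?J) ` {?t1, d, ?t3, ?t4, ?t5}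
        = {?t3, mat3 1 0 0 0 0 0 0 0 0, ?t1, ?t5, ?t4}"
      unfolding d image_insert image_empty mat3_flip ..
    also have "\<dots> = S_alpha 0"
      unfolding S_alpha_def by (simp only: insert_commute)
    finally show ?thesis
      using matset_sim_trans[OF sim] by blast
  qed
qed

section \<open>Transport of configurations by conjugation\<close>

lemma eigenvec_conjugateI:
  fixes g h :: "'a::field^'n^'n"
  assumes "g ** h = mat 1" "eigenvec a v"
  shows "eigenvec (h ** a ** g) (h *v v)"
proof -
  obtain c where c: "a *v v = c *s v"
    using assms(2) unfolding eigenvec_def by (rule exE)
  have "(h ** a ** g) *v (h *v v) = h *v (a *v ((g ** h) *v v))"
    by (simp add: matrix_vector_mul_assoc matrix_mul_assoc)
  also have "\<dots> = c *s (h *v v)"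
    by (simp add: assms(1) c vector_scalar_commute)
  finally show ?thesis
    unfolding eigenvec_def by (rule exI)
qed

lemma eigenvec_conjugate:
  fixes g h :: "'a::field^'n^'n"
  assumes "g ** h = mat 1" "h ** g = mat 1"
  shows "eigenvec (h ** a ** g) (h *v v) \<longleftrightarrow> eigenvec a v"
proof
  assume "eigenvec (h ** a ** g) (h *v v)"
  from eigenvec_conjugateI[OF assms(2) this] show "eigenvec a v"
    by (simp add: conjugate_inverse[OF assms] matrix_vector_mul_assoc assms(1))
qed (rule eigenvec_conjugateI[OF assms(1)])

lemma eigenvec_transpose_conjugate:
  fixes g h :: "'a::field^'n^'n"
  assumes "g ** h = mat 1" "h ** g = mat 1"
  shows "eigenvec (transpose (h ** a ** g)) (transpose g *v u) \<longleftrightarrow> eigenvec (transpose a) u"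
proof -
  have "transpose (h ** a ** g) = transpose g ** transpose a ** transpose h"
    by (simp add: matrix_transpose_mul matrix_mul_assoc)
  moreover have "transpose h ** transpose g = mat 1" "transpose g ** transpose h = mat 1"
    by (simp_all add: assms transpose_mat flip: matrix_transpose_mul)
  ultimately show ?thesis
    using eigenvec_conjugate by metis
qed

lemma isolated_conjugate:
  fixes g h :: "'a::field^'n^'n"
  assumes gh: "g ** h = mat 1" "h ** g = mat 1" and iso: "isolated S a v"
  shows "isolated ((\<lambda>a. h ** a ** g) ` S) (h ** a ** g) (h *v v)"
proof -
  have "v = g *v (h *v v)"
    by (simp add: matrix_vector_mul_assoc gh)
  then have "h *v v \<noteq> 0"
    using iso by (metis isolated_def matrix_vector_mult_0_right)
  then show ?thesis
    using iso unfolding isolated_def by (auto simp: eigenvec_conjugate[OF gh])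
qed

lemma isolated_transpose_conjugate:
  fixes g h :: "'a::field^'n^'n"
  assumes gh: "g ** h = mat 1" "h ** g = mat 1" and iso: "isolated (transpose ` S) (transpose a) u"
  shows "isolated (transpose ` (\<lambda>a. h ** a ** g) ` S) (transpose (h ** a ** g)) (transpose g *v u)"
proof -
  have "u = transpose h *v (transpose g *v u)"
    unfolding matrix_vector_mul_assoc by (simp add: gh transpose_mat flip: matrix_transpose_mul)
  then have "transpose g *v u \<noteq> 0"
    using iso by (metis isolated_def matrix_vector_mult_0_right)
  then show ?thesis
    using iso unfolding isolated_transpose
    by (auto simp: eigenvec_transpose_conjugate[OF gh] simp del: transpose_matrix_vector)
qed

text \<open>The new basis is \<open>v1\<close>, \<open>q\<close>, \<open>v3\<close>, where
  \<open>q = v1 + v3 - v2\<close> is the intersection of the two lines; the dual basis is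
  \<open>u4\<close>, \<open>t\<close>, \<open>u5\<close>. The sign in the definition of
  \<open>q\<close> produces the coordinates 1, -1, 1 of \<open>v2\<close>.\<close>

lemma normalizing_frame:
  fixes v1 v2 v3 u4 u5 :: "'a::field^3"
  assumes "v2 \<noteq> v1 + v3"
    and u4: "dot u4 v1 = 1" "dot u4 v2 = 1" "dot u4 v3 = 0"
    and u5: "dot u5 v1 = 0" "dot u5 v2 = 1" "dot u5 v3 = 1"
  shows "\<exists>(g :: 'a^3^3) (h :: 'a^3^3). g ** h = mat 1 \<and> h ** g = mat 1 \<and> h *v v1 = vector [1, 0, 0] \<and>
    h *v v2 = vector [1, - 1, 1] \<and> h *v v3 = vector [0, 0, 1] \<and>
    transpose g *v u4 = vector [1, 0, 0] \<and> transpose g *v u5 = vector [0, 0, 1]"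
proof -
  define q where "q = v1 + v3 - v2"
  have "q \<noteq> 0"
    using assms(1) by (auto simp: q_def)
  then obtain r where r: "dot r q = 1"
    using ex_dot_eq_1 by blast
  have uq: "dot u4 q = 0" "dot u5 q = 0"
    by (simp_all add: q_def dot_simps u4 u5)
  \<comment> \<open>The functional \<open>r\<close> is corrected by \<open>u4\<close> and
    \<open>u5\<close>, which vanish at \<open>q\<close>, so that it vanishes at \<open>v1\<close>
    and \<open>v3\<close>.\<close>
  define t where "t = r + (- dot r v1) *s u4 + (- dot r v3) *s u5"
  have t: "dot t v1 = 0" "dot t q = 1" "dot t v3 = 0"
    by (simp_all add: t_def dot_simps u4 u5 uq r)
  have "dot t v2 = dot t v1 + dot t v3 - dot t q"
    by (simp add: q_def dot_simps)
  then have tv2: "dot t v2 = - 1"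
    by (simp add: t)
  define h :: "'a^3^3" where "h = vector [u4, t, u5]"
  define g :: "'a^3^3" where "g = transpose (vector [v1, q, v3])"
  have h: "h *v x = vector [dot u4 x, dot t x, dot u5 x]" for x
    by (simp add: h_def vec_eq_iff forall_3 matrix_vector_mult_def dot_def)
  have g: "transpose g *v x = vector [dot x v1, dot x q, dot x v3]" for x
    unfolding g_def transpose_transpose
    by (simp add: vec_eq_iff forall_3 matrix_vector_mult_def dot_def mult.commute)
  have "h ** g = vector [vector [dot u4 v1, dot u4 q, dot u4 v3], vector [dot t v1, dot t q, dot t v3],
      vector [dot u5 v1, dot u5 q, dot u5 v3]]"
    by (simp add: h_def g_def vec_eq_iff forall_3 matrix_matrix_mult_def transpose_def dot_def)
  then have hg: "h ** g = mat 1"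
    by (simp add: u4 u5 t uq vec_eq_iff forall_3 mat_def)
  then have "g ** h = mat 1"
    using matrix_left_right_inverse by blast
  then show ?thesis
    by (intro exI[of _ g] exI[of _ h] conjI) (simp_all only: h g u4 u5 t uq tv2 hg)
qed

lemma zero_of_orthogonal_basis:
  fixes w :: "'a::field^3"
  assumes "dot (cross p q) r \<noteq> 0" "dot w p = 0" "dot w q = 0" "dot w r = 0"
  shows "w = 0"
proof -
  have "cross p q \<noteq> 0"
    using assms(1) by (auto simp: dot_simps)
  then obtain c where c: "w = c *s cross p q"
    using orthogonal_imp_multiple_cross assms by blast
  then have "c = 0"
    using assms(1,4) by (simp add: dot_simps)
  then show ?thesis using c by simp
qed

text \<open>Three points and two lines, labelled by the elements of \<open>S\<close> that they
  isolate. Relabelled configurations are instances of the same locale, which replaces arguments by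
  symmetry.\<close>

locale points_lines =
  fixes S :: "('a::alg_closed_field^3^3) set" and a1 a2 a3 a4 a5 and v1 v2 v3 u4 u5
  assumes irr: "irredundant_generating_set S"
    and S: "S = {a1, a2, a3, a4, a5}" "distinct [a1, a2, a3, a4, a5]"
    and iso: "isolated S a1 v1" "isolated S a2 v2" "isolated S a3 v3"
      "isolated (transpose ` S) (transpose a4) u4" "isolated (transpose ` S) (transpose a5) u5"
begin

lemma swap_points:
  "points_lines S a2 a1 a3 a4 a5 v2 v1 v3 u4 u5" "points_lines S a1 a3 a2 a4 a5 v1 v3 v2 u4 u5"
proof -
  have "S = {a2, a1, a3, a4, a5}" "S = {a1, a3, a2, a4, a5}"
    unfolding S(1) by (simp_all only: insert_commute)
  moreover have "distinct [a2, a1, a3, a4, a5]" "distinct [a1, a3, a2, a4, a5]"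
    using S(2) by auto
  ultimately show "points_lines S a2 a1 a3 a4 a5 v2 v1 v3 u4 u5" "points_lines S a1 a3 a2 a4 a5 v1 v3 v2 u4 u5"
    using irr iso by (simp_all add: points_lines_def)
qed

lemma swap_lines: "points_lines S a1 a2 a3 a5 a4 v1 v2 v3 u5 u4"
proof -
  have "S = {a1, a2, a3, a5, a4}"
    unfolding S(1) by (simp only: insert_commute)
  moreover have "distinct [a1, a2, a3, a5, a4]"
    using S(2) by auto
  ultimately show ?thesis
    using irr iso by (simp add: points_lines_def)
qed

text \<open>Only four of the five vectors are rescaled; that is enough to normalize the four nonzero
  pairings.\<close>

lemma scale:
  assumes "c1 \<noteq> 0" "c2 \<noteq> 0" "c3 \<noteq> 0" "c5 \<noteq> 0"
  shows "points_lines S a1 a2 a3 a4 a5 (c1 *s v1) (c2 *s v2) (c3 *s v3) u4 (c5 *s u5)"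
  using irr S iso assms by unfold_locales (simp_all add: isolated_scale)

section \<open>Incidences between the points and the lines\<close>

lemma in_S: "a1 \<in> S" "a2 \<in> S" "a3 \<in> S" "a4 \<in> S" "a5 \<in> S"
  using S by auto

lemma independent: "dot (cross v1 v2) v3 \<noteq> 0"
  using isolated_independent[OF _ iso(1-3) in_S(1-3)] irr S(2)
  by (simp add: irredundant_generating_set_def)

lemma cross_nonzero: "cross v1 v2 \<noteq> 0" "cross v1 v3 \<noteq> 0" "cross v2 v3 \<noteq> 0"
  using isolated_cross_nonzero[OF iso(1,2) in_S(1)] isolated_cross_nonzero[OF iso(1,3) in_S(1)]
    isolated_cross_nonzero[OF iso(2,3) in_S(2)] S(2) by simp_all

lemma eigenvec_points:
  "b \<in> S \<Longrightarrow> b \<noteq> a1 \<Longrightarrow> eigenvec b v1" "b \<in> S \<Longrightarrow> b \<noteq> a2 \<Longrightarrow> eigenvec b v2"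
  "b \<in> S \<Longrightarrow> b \<noteq> a3 \<Longrightarrow> eigenvec b v3"
  using iso(1-3) unfolding isolated_def by simp_all

lemma eigenvec_lines:
  "b \<in> S \<Longrightarrow> b \<noteq> a4 \<Longrightarrow> eigenvec (transpose b) u4" "b \<in> S \<Longrightarrow> b \<noteq> a5 \<Longrightarrow> eigenvec (transpose b) u5"
  using iso(4,5) unfolding isolated_transpose by simp_all

lemma eigenvec4: "eigenvec a4 v1" "eigenvec a4 v2" "eigenvec a4 v3" "eigenvec (transpose a4) u5"
  and eigenvec5: "eigenvec a5 v1" "eigenvec a5 v2" "eigenvec a5 v3" "eigenvec (transpose a5) u4"
  using S(2) by (auto intro!: eigenvec_points eigenvec_lines in_S simp del: transpose_matrix_vector)

lemma not_eigenvec4: "\<not> eigenvec (transpose a4) u4" and u4_nonzero: "u4 \<noteq> 0"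
  using iso(4) unfolding isolated_transpose by simp_all

text \<open>If the line \<open>u4\<close> avoided all three points, its eigenvalue under
  \<open>a5\<close> would be shared by all of them, and \<open>a5\<close> would be scalar.\<close>

lemma not_all_nonzero: "dot u4 v1 = 0 \<or> dot u4 v2 = 0 \<or> dot u4 v3 = 0"
proof (rule ccontr)
  assume nz: "\<not> ?thesis"
  obtain c where c: "u4 v* a5 = c *s u4"
    using eigenvec5(4) unfolding eigenvec_transpose by (rule exE)
  have "a5 *v x = c *s x" if "eigenvec a5 x" "dot u4 x \<noteq> 0" for x
    using that eigenvalues_agree[OF c] unfolding eigenvec_def by metis
  then have "a5 = mat c"
    using scalar_on_basis[OF independent] eigenvec5(1-3) nz by blast
  then show False
    using irredundant_not_scalar[OF irr in_S(5)] by blast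
qed

text \<open>The element \<open>a4\<close> fixes all three points, so it would fix a line through two
  of them; but it does not fix \<open>u4\<close>.\<close>

lemma not_two_zero:
  "\<not> (dot u4 v1 = 0 \<and> dot u4 v2 = 0)" "\<not> (dot u4 v1 = 0 \<and> dot u4 v3 = 0)"
  "\<not> (dot u4 v2 = 0 \<and> dot u4 v3 = 0)"
  using plane_eigenvec[OF cross_nonzero(1) _ _ u4_nonzero eigenvec4(1,2)]
    plane_eigenvec[OF cross_nonzero(2) _ _ u4_nonzero eigenvec4(1,3)]
    plane_eigenvec[OF cross_nonzero(3) _ _ u4_nonzero eigenvec4(2,3)] not_eigenvec4 by blast+

lemma one_zero:
  "dot u4 v1 = 0 \<and> dot u4 v2 \<noteq> 0 \<and> dot u4 v3 \<noteq> 0 \<or>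
   dot u4 v1 \<noteq> 0 \<and> dot u4 v2 = 0 \<and> dot u4 v3 \<noteq> 0 \<or>
   dot u4 v1 \<noteq> 0 \<and> dot u4 v2 \<noteq> 0 \<and> dot u4 v3 = 0"
  using not_all_nonzero not_two_zero by blast

text \<open>As \<open>u5\<close> is fixed by \<open>a4\<close> and avoids \<open>v2\<close> and
  \<open>v3\<close>, these two points share an eigenvalue c under \<open>a4\<close>. If
  \<open>u4\<close> passed through \<open>v1\<close>, then \<open>u4 v* a4\<close> and c times
  \<open>u4\<close> would agree on the basis of the three points, so \<open>a4\<close> would fix
  \<open>u4\<close>.\<close>

lemma zeros_differ:
  assumes "dot u5 v2 \<noteq> 0" "dot u5 v3 \<noteq> 0"
  shows "\<not> (dot u4 v1 = 0 \<and> dot u5 v1 = 0)"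
proof
  assume 0: "dot u4 v1 = 0 \<and> dot u5 v1 = 0"
  obtain c where c: "u5 v* a4 = c *s u5"
    using eigenvec4(4) unfolding eigenvec_transpose by (rule exE)
  obtain d where d: "a4 *v v1 = d *s v1"
    using eigenvec4(1) unfolding eigenvec_def by (rule exE)
  have "a4 *v x = c *s x" if "eigenvec a4 x" "dot u5 x \<noteq> 0" for x
    using that eigenvalues_agree[OF c] unfolding eigenvec_def by metis
  then have "a4 *v v2 = c *s v2" "a4 *v v3 = c *s v3"
    using eigenvec4 assms by blast+
  then have "dot (u4 v* a4 + (- c) *s u4) v1 = 0" "dot (u4 v* a4 + (- c) *s u4) v2 = 0"
    "dot (u4 v* a4 + (- c) *s u4) v3 = 0"
    using 0 d by (simp_all add: dot_simps dot_matrix_vector[symmetric])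
  then have "u4 v* a4 + (- c) *s u4 = 0"
    using zero_of_orthogonal_basis[OF independent] by blast
  then have "u4 v* a4 = c *s u4"
    by (simp add: vec_eq_iff eq_neg_iff_add_eq_0)
  then show False
    using not_eigenvec4 unfolding eigenvec_transpose by blast
qed

lemma normalized_sim:
  assumes u4: "dot u4 v1 = 1" "dot u4 v2 = 1" "dot u4 v3 = 0"
    and u5: "dot u5 v1 = 0" "dot u5 v2 = 1" "dot u5 v3 = 1"
  shows "\<exists>\<alpha>. S \<sim> S_alpha \<alpha>"
proof -
  have "v2 \<noteq> v1 + v3"
    using independent by (auto simp: dot_3 algebra_simps)
  then obtain g h :: "'a^3^3" where gh: "g ** h = mat 1" "h ** g = mat 1"
    and hv: "h *v v1 = vector [1, 0, 0]" "h *v v2 = vector [1, - 1, 1]" "h *v v3 = vector [0, 0, 1]"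
    and gu: "transpose g *v u4 = vector [1, 0, 0]" "transpose g *v u5 = vector [0, 0, 1]"
    using normalizing_frame[OF _ u4 u5] by metis
  let ?c = "\<lambda>a. h ** a ** g"
  have "inj ?c"
    by (rule inj_on_inverseI[of _ "\<lambda>a. g ** a ** h"]) (rule conjugate_inverse[OF gh])
  then have "distinct (map ?c [a1, a2, a3, a4, a5])"
    using S(2) unfolding distinct_map by (metis inj_on_subset subset_UNIV)
  then have dist: "distinct [?c a1, ?c a2, ?c a3, ?c a4, ?c a5]"
    by simp
  have "?c ` S = {?c a1, ?c a2, ?c a3, ?c a4, ?c a5}"
    unfolding S(1) by simp
  then have "\<exists>\<alpha>. ?c ` S \<sim> S_alpha \<alpha>"
    using coordinate_configuration_sim[OF _ _ dist] irredundant_conjugate_iff[OF gh(2,1)] irr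
      isolated_conjugate[OF gh iso(1)] isolated_conjugate[OF gh iso(2)] isolated_conjugate[OF gh iso(3)]
      isolated_transpose_conjugate[OF gh iso(4)] isolated_transpose_conjugate[OF gh iso(5)]
    unfolding hv gu by blast
  then show ?thesis
    using matset_sim_trans[OF matset_sim_conjugate[OF gh(2,1)]] by blast
qed

lemma standard_sim:
  assumes u4: "dot u4 v1 \<noteq> 0" "dot u4 v2 \<noteq> 0" "dot u4 v3 = 0"
    and u5: "dot u5 v1 = 0" "dot u5 v2 \<noteq> 0" "dot u5 v3 \<noteq> 0"
  shows "\<exists>\<alpha>. S \<sim> S_alpha \<alpha>"
proof -
  \<comment> \<open>The factors are fixed in turn: \<open>v1\<close> and \<open>v2\<close> against
    \<open>u4\<close>, then \<open>u5\<close> against the scaled \<open>v2\<close>, then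
    \<open>v3\<close> against the scaled \<open>u5\<close>.\<close>
  define c1 where "c1 = inverse (dot u4 v1)"
  define c2 where "c2 = inverse (dot u4 v2)"
  define c5 where "c5 = inverse (c2 * dot u5 v2)"
  define c3 where "c3 = inverse (c5 * dot u5 v3)"
  have nz: "c1 \<noteq> 0" "c2 \<noteq> 0" "c3 \<noteq> 0" "c5 \<noteq> 0"
    using u4 u5 by (simp_all add: c1_def c2_def c3_def c5_def)
  interpret scaled: points_lines S a1 a2 a3 a4 a5 "c1 *s v1" "c2 *s v2" "c3 *s v3" u4 "c5 *s u5"
    using nz by (rule scale)
  show ?thesis
  proof (rule scaled.normalized_sim)
    show "dot u4 (c1 *s v1) = 1" "dot u4 (c2 *s v2) = 1" "dot u4 (c3 *s v3) = 0"
      "dot (c5 *s u5) (c1 *s v1) = 0"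
      using u4 u5 by (simp_all add: dot_simps c1_def c2_def)
    show "dot (c5 *s u5) (c2 *s v2) = 1"
      using u5 nz by (simp add: dot_simps c5_def field_simps)
    show "dot (c5 *s u5) (c3 *s v3) = 1"
      using u5 nz by (simp add: dot_simps c3_def field_simps)
  qed
qed

text \<open>The two lines pass through different points, one each. These are six incidence patterns,
  one for each order of the points.\<close>

lemma sim: "\<exists>\<alpha>. S \<sim> S_alpha \<alpha>"
proof -
  interpret l: points_lines S a1 a2 a3 a5 a4 v1 v2 v3 u5 u4 by (rule swap_lines)
  interpret p213: points_lines S a2 a1 a3 a4 a5 v2 v1 v3 u4 u5 by (rule swap_points)
  interpret p132: points_lines S a1 a3 a2 a4 a5 v1 v3 v2 u4 u5 by (rule swap_points)
  interpret p231: points_lines S a2 a3 a1 a4 a5 v2 v3 v1 u4 u5 by (rule p213.swap_points)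
  interpret p312: points_lines S a3 a1 a2 a4 a5 v3 v1 v2 u4 u5 by (rule p132.swap_points)
  interpret p321: points_lines S a3 a2 a1 a4 a5 v3 v2 v1 u4 u5 by (rule p231.swap_points)
  show ?thesis
    using one_zero l.one_zero zeros_differ p213.zeros_differ p312.zeros_differ standard_sim
      p213.standard_sim p132.standard_sim p231.standard_sim p312.standard_sim p321.standard_sim
    by metis
qed

end

text \<open>Since four isolated points are impossible, the two remaining elements must have isolated
  lines.\<close>

lemma three_isolated_sim:
  fixes S :: "('a::alg_closed_field^3^3) set"
  assumes irr: "irredundant_generating_set S" and "card S = 5"
    and "3 \<le> card {a \<in> S. \<exists>v. isolated S a v}"
  shows "\<exists>\<alpha>. S \<sim> S_alpha \<alpha>"
proof -
  obtain P where P: "P \<subseteq> {a \<in> S. \<exists>v. isolated S a v}" "card P = 3"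
    by (rule obtain_subset_with_card_n[OF assms(3)])
  then obtain a1 a2 a3 where a: "P = {a1, a2, a3}" "a1 \<noteq> a2" "a1 \<noteq> a3" "a2 \<noteq> a3"
    unfolding card_3_iff by metis
  have "finite S" "P \<subseteq> S"
    using assms(2) P by (auto intro: card_ge_0_finite)
  then have "card (S - P) = 2"
    using P assms(2) by (simp add: card_Diff_subset finite_subset)
  then obtain a4 a5 where b: "S - P = {a4, a5}" "a4 \<noteq> a5"
    unfolding card_2_iff by metis
  have S: "S = {a1, a2, a3, a4, a5}"
    using a b \<open>P \<subseteq> S\<close> by auto
  have "a4 \<notin> P" "a5 \<notin> P"
    using b(1) by auto
  then have dist: "distinct [a1, a2, a3, a4, a5]"
    using a b by auto
  obtain v1 v2 v3 where v: "isolated S a1 v1" "isolated S a2 v2" "isolated S a3 v3"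
    using P(1) unfolding a(1) by auto
  have "\<nexists>v. isolated S a4 v"
    using not_four_isolated[OF irr dist _ v] S by blast
  then obtain u4 where u4: "isolated (transpose ` S) (transpose a4) u4"
    using irredundant_isolated[OF irr, of a4] S by blast
  have "distinct [a1, a2, a3, a5, a4]" "{a1, a2, a3, a5, a4} \<subseteq> S"
    using dist S by auto
  then have "\<nexists>v. isolated S a5 v"
    using not_four_isolated[OF irr _ _ v] by blast
  then obtain u5 where u5: "isolated (transpose ` S) (transpose a5) u5"
    using irredundant_isolated[OF irr, of a5] S by blast
  interpret points_lines S a1 a2 a3 a4 a5 v1 v2 v3 u4 u5
    by unfold_locales (fact irr S dist v u4 u5)+
  show ?thesis by (rule sim)
qed

text \<open>Of five elements at least three have isolated points or at least three have isolated
  lines; transposition exchanges the two cases.\<close>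

lemma irredundant_card_5_sim:
  fixes S :: "('a::alg_closed_field^3^3) set"
  assumes irr: "irredundant_generating_set S" and card: "card S = 5"
  shows "\<exists>\<alpha>. S \<sim> S_alpha \<alpha>"
proof (cases "3 \<le> card {a \<in> S. \<exists>v. isolated S a v}")
  case True
  then show ?thesis using three_isolated_sim assms by blast
next
  case False
  let ?P = "{a \<in> S. \<exists>v. isolated S a v}"
  let ?Q = "{a \<in> S. \<exists>u. isolated (transpose ` S) (transpose a) u}"
  have inj: "inj (transpose :: 'a^3^3 \<Rightarrow> _)"
    by (rule inj_transpose)
  have "S = ?P \<union> ?Q"
    using irredundant_isolated[OF irr] by blast
  then have "3 \<le> card ?Q"
    using card card_Un_le[of ?P ?Q] False by simp
  also have "\<dots> = card (transpose ` ?Q)"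
    by (simp add: card_image inj_on_subset[OF inj])
  also have "transpose ` ?Q = {a \<in> transpose ` S. \<exists>u. isolated (transpose ` S) a u}"
    by auto
  finally have "3 \<le> card {a \<in> transpose ` S. \<exists>u. isolated (transpose ` S) a u}" .
  moreover have "card (transpose ` S) = 5"
    by (simp add: card card_image inj_on_subset[OF inj])
  ultimately have "\<exists>\<alpha>. transpose ` S \<sim> S_alpha \<alpha>"
    using three_isolated_sim irredundant_transpose_iff irr by blast
  then show ?thesis
    using matset_sim_trans[OF matset_sim_step[OF elementary_step.transpose]] by blast
qed

section \<open>The sets \<open>S_alpha\<close>\<close>

lemma card_S_alpha: "card (S_alpha \<alpha>) = 5"
  by (simp add: S_alpha_def card_insert_if vec_eq_iff forall_3)

text \<open>An eigenvector of a rank one matrix lies in the kernel or spans the image. For the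
  diagonal matrix, the first two diagonal entries differ for every \<alpha>.\<close>

lemma eigenvec_S_alpha:
  fixes v :: "'a::field^3"
  shows "eigenvec (mat3 1 1 0 0 0 0 0 0 0) v \<Longrightarrow> v$1 + v$2 = 0 \<or> v$2 = 0 \<and> v$3 = 0"
    "eigenvec (mat3 0 0 0 1 1 0 0 0 0) v \<Longrightarrow> v$1 + v$2 = 0 \<or> v$1 = 0 \<and> v$3 = 0"
    "eigenvec (mat3 0 0 0 0 1 1 0 0 0) v \<Longrightarrow> v$2 + v$3 = 0 \<or> v$1 = 0 \<and> v$3 = 0"
    "eigenvec (mat3 0 0 0 0 0 0 0 1 1) v \<Longrightarrow> v$2 + v$3 = 0 \<or> v$1 = 0 \<and> v$2 = 0"
    "eigenvec (mat3 1 0 0 0 0 0 0 0 \<alpha>) v \<Longrightarrow> v$1 = 0 \<or> v$2 = 0"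
  unfolding eigenvec_def
  by (auto simp: matrix_vector_mult_def sum_3 vec_eq_iff forall_3)

lemma left_eigenvec_S_alpha:
  fixes u :: "'a::field^3"
  shows "eigenvec (transpose (mat3 1 1 0 0 0 0 0 0 0)) u \<Longrightarrow> u$1 = 0 \<or> u$1 = u$2"
    "eigenvec (transpose (mat3 0 0 0 1 1 0 0 0 0)) u \<Longrightarrow> u$2 = 0 \<or> u$1 = u$2 \<and> u$3 = 0"
    "eigenvec (transpose (mat3 0 0 0 0 1 1 0 0 0)) u \<Longrightarrow> u$2 = 0 \<or> u$1 = 0 \<and> u$3 = u$2"
    "eigenvec (transpose (mat3 0 0 0 0 0 0 0 1 1)) u \<Longrightarrow> u$3 = 0 \<or> u$3 = u$2"
  unfolding eigenvec_transpose
  by (auto simp: vector_matrix_mult_def sum_3 vec_eq_iff forall_3)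

lemma generates_S_alpha: "generates_matrix_algebra (S_alpha (\<alpha> :: 'a::alg_closed_field))"
proof (rule ccontr)
  assume "\<not> ?thesis"
  from not_generates_common_eigenvec[OF this] show False
  proof (elim disjE exE conjE)
    fix v :: "'a^3" assume v: "v \<noteq> 0" "\<forall>a\<in>S_alpha \<alpha>. eigenvec a v"
    \<comment> \<open>The first two matrices force \<open>v$1 + v$2 = 0\<close>, since their other
      alternatives together give \<open>v = 0\<close>. The next two matrices give the second
      equation in the same way.\<close>
    then have "v$1 + v$2 = 0" "v$2 + v$3 = 0" "v$1 = 0 \<or> v$2 = 0"
      unfolding S_alpha_def using eigenvec_S_alpha[where v = v] by auto
    then have "v = 0"
      by (auto simp: vec_eq_iff forall_3)
    with v(1) show False ..
  next
    fix u :: "'a^3" assume u: "u \<noteq> 0" "\<forall>a\<in>S_alpha \<alpha>. eigenvec (transpose a) u"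
    then have "u$2 = 0" "u$3 = 0 \<or> u$3 = u$2" "u$1 = 0 \<or> u$1 = u$2"
      unfolding S_alpha_def using left_eigenvec_S_alpha[where u = u]
      by (auto simp del: transpose_matrix_vector)
    then have "u = 0"
      by (auto simp: vec_eq_iff forall_3)
    with u(1) show False ..
  qed
qed

text \<open>Each element is the only one that moves a certain point or line of the reference
  configuration, so omitting it leaves a common eigenvector on one side.\<close>

lemma irredundant_S_alpha: "irredundant_generating_set (S_alpha (\<alpha> :: 'a::alg_closed_field))"
  unfolding irredundant_generating_set_def
proof (intro conjI allI impI)
  fix T assume "T \<subset> S_alpha \<alpha>"
  then obtain a where a: "a \<in> S_alpha \<alpha>" "a \<notin> T" "T \<subseteq> S_alpha \<alpha>"
    by blast
  let ?t1 = "mat3 0 0 0 1 1 0 0 0 0 :: 'a^3^3"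
  let ?t3 = "mat3 0 0 0 0 1 1 0 0 0 :: 'a^3^3"
  let ?t4 = "mat3 1 1 0 0 0 0 0 0 0 :: 'a^3^3"
  let ?t5 = "mat3 0 0 0 0 0 0 0 1 1 :: 'a^3^3"
  let ?d = "mat3 1 0 0 0 0 0 0 0 \<alpha> :: 'a^3^3"
  have ev: "b = ?t1 \<or> eigenvec b (vector [1, 0, 0])" "b = ?t3 \<or> eigenvec b (vector [0, 0, 1])"
    "b = ?d \<or> eigenvec b (vector [1, - 1, 1])" "b = ?t4 \<or> eigenvec (transpose b) (vector [1, 0, 0])"
    "b = ?t5 \<or> eigenvec (transpose b) (vector [0, 0, 1])" if "b \<in> S_alpha \<alpha>" for b
    using that by (auto simp: S_alpha_def eigenvec_coordinates transpose_entry simp del: transpose_matrix_vector)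
  have nz: "vector [1, 0, 0] \<noteq> (0 :: 'a^3)" "vector [0, 0, 1] \<noteq> (0 :: 'a^3)" "vector [1, - 1, 1] \<noteq> (0 :: 'a^3)"
    by (simp_all add: vec_eq_iff forall_3)
  show "\<not> generates_matrix_algebra T"
  proof
    assume gen: "generates_matrix_algebra T"
    note v = generates_no_common_eigenvec[OF gen nz(1)] generates_no_common_eigenvec[OF gen nz(2)]
      generates_no_common_eigenvec[OF gen nz(3)] generates_no_common_eigenvec[OF generates_transpose[OF gen] nz(1)]
      generates_no_common_eigenvec[OF generates_transpose[OF gen] nz(2)]
    consider "a = ?t1" | "a = ?t3" | "a = ?t4" | "a = ?t5" | "a = ?d"
      using a(1) unfolding S_alpha_def by blast
    then show False
      using v a(2,3) ev by cases (metis image_iff subsetD)+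
  qed
qed (rule generates_S_alpha)

theorem theorem1p2:
  fixes S :: "('a::alg_closed_field ^ 3 ^ 3) set"
  assumes "card S = 5"
  shows "irredundant_generating_set S \<longleftrightarrow> (\<exists>\<alpha>. S \<sim> S_alpha \<alpha>)"
proof
  assume "\<exists>\<alpha>. S \<sim> S_alpha \<alpha>"
  then obtain \<alpha> where "S \<sim> S_alpha \<alpha>" ..
  moreover have "finite S"
    by (rule card_ge_0_finite) (simp add: assms)
  moreover have "card S = card (S_alpha \<alpha>)"
    by (simp add: assms card_S_alpha)
  ultimately show "irredundant_generating_set S"
    using irredundant_S_alpha by (rule matset_sim_irredundant)
qed (rule irredundant_card_5_sim[OF _ assms])

end
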